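(* Let $G$ be a group and $N$ a normal subgroup such that $\Gamma=G/N$ is a finitely generated abelian group. Assume the comparison map $c^2_G\colon\mathrm{H}^2_b(G)\to\mathrm{H}^2(G)$ is surjective. Let $p\colon G\to\Gamma$ be the quotient map and $\mathcal{H}$ the image of $\mathrm{H}^1(p)\colon\mathrm{H}^1(\Gamma)\to\mathrm{H}^1(G)$. Then $$\dim_{\mathbb{R}}\mathrm{W}(G,N)=\dim_{\mathbb{R}}\operatorname{Im}(\smile\colon\mathcal{H}\otimes\mathcal{H}\to\mathrm{H}^2(G)),$$ where $\smile$ is the cup product.
   Context: Cohomology and bounded cohomology with trivial real coefficients; $c^2_G$ is induced by inclusion of bounded cochains into all cochains. $\mathrm{Q}(N)^G$: homogeneous quasimorphisms on $N$ invariant under $G$-conjugation; $\mathrm{H}^1(N)^G$: $G$-invariant homomorphisms $N\to\mathbb{R}$; $\mathrm{Q}(G)$: homogeneous quasimorphisms on $G$; $\mathrm{W}(G,N)=\mathrm{Q}(N)^G/(\mathrm{H}^1(N)^G+\{\psi|_N:\psi\in\mathrm{Q}(G)\})$. *)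

theory Defs
  imports Complex_Main "HOL-Algebra.Algebra"
begin

definition fspan :: "('x \<Rightarrow> real) set \<Rightarrow> ('x \<Rightarrow> real) set" where
  "fspan S = {f. \<exists>B c. finite B \<and> B \<subseteq> S \<and> f = (\<lambda>x. \<Sum>b\<in>B. c b * b x)}"

definition indep_mod :: "('x \<Rightarrow> real) set \<Rightarrow> ('x \<Rightarrow> real) set \<Rightarrow> bool" where
  "indep_mod U B \<longleftrightarrow> (\<forall>c. (\<lambda>x. \<Sum>b\<in>B. c b * b x) \<in> fspan U \<longrightarrow> (\<forall>b\<in>B. c b = 0))"

text \<open>quot_dim V U n: the quotient space (span V + span U) / span U has finite
  real dimension n (witnessed by a basis B of the quotient).\<close>
definition quot_dim :: "('x \<Rightarrow> real) set \<Rightarrow> ('x \<Rightarrow> real) set \<Rightarrow> nat \<Rightarrow> bool" where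
  "quot_dim V U n \<longleftrightarrow> (\<exists>B. finite B \<and> card B = n \<and> B \<subseteq> fspan V
      \<and> V \<subseteq> fspan (B \<union> U) \<and> indep_mod U B)"

definition real_hom :: "('a, 'b) monoid_scheme \<Rightarrow> 'a set \<Rightarrow> ('a \<Rightarrow> real) \<Rightarrow> bool" where
  "real_hom G H f \<longleftrightarrow> (\<forall>x. x \<notin> H \<longrightarrow> f x = 0)
     \<and> (\<forall>x\<in>H. \<forall>y\<in>H. f (x \<otimes>\<^bsub>G\<^esub> y) = f x + f y)"

definition hom_qm :: "('a, 'b) monoid_scheme \<Rightarrow> 'a set \<Rightarrow> ('a \<Rightarrow> real) \<Rightarrow> bool" where
  "hom_qm G H f \<longleftrightarrow> (\<forall>x. x \<notin> H \<longrightarrow> f x = 0)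
     \<and> (\<exists>D. \<forall>x\<in>H. \<forall>y\<in>H. \<bar>f (x \<otimes>\<^bsub>G\<^esub> y) - f x - f y\<bar> \<le> D)
     \<and> (\<forall>x\<in>H. \<forall>n::int. f (x [^]\<^bsub>G\<^esub> n) = of_int n * f x)"

definition conj_inv :: "('a, 'b) monoid_scheme \<Rightarrow> 'a set \<Rightarrow> ('a \<Rightarrow> real) \<Rightarrow> bool" where
  "conj_inv G N f \<longleftrightarrow> (\<forall>g\<in>carrier G. \<forall>x\<in>N. f (g \<otimes>\<^bsub>G\<^esub> x \<otimes>\<^bsub>G\<^esub> inv\<^bsub>G\<^esub> g) = f x)"

definition QNG :: "('a, 'b) monoid_scheme \<Rightarrow> 'a set \<Rightarrow> ('a \<Rightarrow> real) set" where
  "QNG G N = {f. hom_qm G N f \<and> conj_inv G N f}"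

definition H1NG :: "('a, 'b) monoid_scheme \<Rightarrow> 'a set \<Rightarrow> ('a \<Rightarrow> real) set" where
  "H1NG G N = {f. real_hom G N f \<and> conj_inv G N f}"

definition QG_restr :: "('a, 'b) monoid_scheme \<Rightarrow> 'a set \<Rightarrow> ('a \<Rightarrow> real) set" where
  "QG_restr G N = {(\<lambda>x. if x \<in> N then \<psi> x else 0) | \<psi>. hom_qm G (carrier G) \<psi>}"

definition cocycle2 :: "('a, 'b) monoid_scheme \<Rightarrow> ('a \<times> 'a \<Rightarrow> real) \<Rightarrow> bool" where
  "cocycle2 G f \<longleftrightarrow> (\<forall>g\<in>carrier G. \<forall>h\<in>carrier G. \<forall>k\<in>carrier G.
      f (h, k) - f (g \<otimes>\<^bsub>G\<^esub> h, k) + f (g, h \<otimes>\<^bsub>G\<^esub> k) - f (g, h) = 0)"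

definition cobound1 :: "('a, 'b) monoid_scheme \<Rightarrow> ('a \<Rightarrow> real) \<Rightarrow> ('a \<times> 'a \<Rightarrow> real)" where
  "cobound1 G \<phi> = (\<lambda>(g, h). if g \<in> carrier G \<and> h \<in> carrier G
       then \<phi> h - \<phi> (g \<otimes>\<^bsub>G\<^esub> h) + \<phi> g else 0)"

definition B2 :: "('a, 'b) monoid_scheme \<Rightarrow> ('a \<times> 'a \<Rightarrow> real) set" where
  "B2 G = range (cobound1 G)"

text \<open>Surjectivity of the comparison map H^2_b(G) -> H^2(G): every 2-cocycle is
  cohomologous to a bounded 2-cocycle.\<close>
definition comparison2_surj :: "('a, 'b) monoid_scheme \<Rightarrow> bool" where
  "comparison2_surj G \<longleftrightarrow> (\<forall>f. cocycle2 G f \<longrightarrow>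
     (\<exists>\<beta> \<phi>. cocycle2 G \<beta> \<and> (\<exists>C. \<forall>g\<in>carrier G. \<forall>h\<in>carrier G. \<bar>\<beta> (g, h)\<bar> \<le> C)
        \<and> (\<forall>g\<in>carrier G. \<forall>h\<in>carrier G. f (g, h) = \<beta> (g, h) + cobound1 G \<phi> (g, h))))"

definition pullH1 :: "('a, 'b) monoid_scheme \<Rightarrow> 'a set \<Rightarrow> ('a \<Rightarrow> real) set" where
  "pullH1 G N = {(\<lambda>g. if g \<in> carrier G then \<chi> (N #>\<^bsub>G\<^esub> g) else 0) | \<chi>.
       real_hom (G Mod N) (carrier (G Mod N)) \<chi>}"

definition cup11 :: "('a \<Rightarrow> real) \<Rightarrow> ('a \<Rightarrow> real) \<Rightarrow> ('a \<times> 'a \<Rightarrow> real)" where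
  "cup11 a b = (\<lambda>(g, h). a g * b h)"

end

theory Submission
  imports Defs
begin

text \<open>Elements of the span of the cup products are the bilinear forms \<open>w\<close> on \<open>G\<close> that vanish on
  \<open>N\<close>. If \<open>\<phi> : G \<rightarrow> \<real>\<close> satisfies \<open>\<delta>\<phi> = w\<close> up to a bounded error, then \<open>\<phi>\<close> restricted to \<open>N\<close> is
  within bounded distance of a \<open>G\<close>-invariant homogeneous quasimorphism \<open>f\<close>; write \<open>w ~ f\<close>. This
  linear relation induces the isomorphism between the two quotients.

  Every \<open>w\<close> is related to some \<open>f\<close> because the comparison map is surjective. Conversely, for an
  invariant \<open>f\<close> the function \<open>f [x, y]\<close> is within bounded distance of an alternating bilinear
  form \<open>- 2 w\<close>, and \<open>f\<close> extends to \<open>G\<close> with \<open>\<delta>\<phi> = w\<close> up to a bounded error, one generator of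
  \<open>G / N\<close> at a time. Finally, if \<open>w ~ f\<close> and \<open>f\<close> is the sum of an invariant homomorphism and
  the restriction of a quasimorphism of \<open>G\<close>, then \<open>\<phi>\<close> can be changed to a homogeneous function
  that is a homomorphism on \<open>N\<close>, and expanding \<open>\<phi> ((x y)\<^sup>n)\<close> turns \<open>\<delta>\<phi> = w\<close> into an exact
  equation, so that \<open>w\<close> is a coboundary.\<close>

section \<open>Quotients of spaces of real functions\<close>

definition flin :: "('x \<Rightarrow> real) set \<Rightarrow> bool" where
  "flin S \<longleftrightarrow> (\<lambda>_. 0) \<in> S \<and> (\<forall>f\<in>S. \<forall>g\<in>S. \<forall>a b. (\<lambda>x. a * f x + b * g x) \<in> S)"

lemma flinD: "flin S \<Longrightarrow> f \<in> S \<Longrightarrow> g \<in> S \<Longrightarrow> (\<lambda>x. a * f x + b * g x) \<in> S"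
  by (simp add: flin_def)

lemma flin_sum:
  assumes "flin S" "finite B" "\<And>b. b \<in> B \<Longrightarrow> F b \<in> S"
  shows "(\<lambda>x. \<Sum>b\<in>B. c b * F b x) \<in> S"
  using assms(2,3)
proof (induction B rule: finite_induct)
  case empty
  then show ?case using assms(1) by (simp add: flin_def)
next
  case (insert b B)
  then show ?case
    using flinD[OF assms(1), of "F b" "\<lambda>x. \<Sum>b\<in>B. c b * F b x" "c b" 1] by simp
qed

lemma fspan_least: "flin T \<Longrightarrow> S \<subseteq> T \<Longrightarrow> fspan S \<subseteq> T"
  unfolding fspan_def using flin_sum[of T _ "\<lambda>b. b"] by blast

lemma fspan_superset: "S \<subseteq> fspan S"
proof
  fix f assume "f \<in> S"
  then show "f \<in> fspan S"
    unfolding fspan_def by (intro CollectI exI[of _ "{f}"] exI[of _ "\<lambda>_. 1"]) auto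
qed

lemma flin_fspan: "flin (fspan S)"
  unfolding flin_def
proof (intro conjI ballI allI)
  show "(\<lambda>_. 0) \<in> fspan S"
    unfolding fspan_def by (intro CollectI exI[of _ "{}"]) auto
next
  fix f g a b assume "f \<in> fspan S" "g \<in> fspan S"
  then obtain B c B' c' where
    f: "finite B" "B \<subseteq> S" "f = (\<lambda>x. \<Sum>b\<in>B. c b * b x)" and
    g: "finite B'" "B' \<subseteq> S" "g = (\<lambda>x. \<Sum>b\<in>B'. c' b * b x)"
    unfolding fspan_def by blast
  have "a * f x + b * g x = (\<Sum>h\<in>B\<union>B'. (a * (if h \<in> B then c h else 0) + b * (if h \<in> B' then c' h else 0)) * h x)" for x
  proof -
    have "(\<Sum>h\<in>B\<union>B'. (if h \<in> B then c h else 0) * h x) = f x"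
      unfolding f(3) by (rule sum.mono_neutral_cong_right) (use f g in auto)
    moreover have "(\<Sum>h\<in>B\<union>B'. (if h \<in> B' then c' h else 0) * h x) = g x"
      unfolding g(3) by (rule sum.mono_neutral_cong_right) (use f g in auto)
    ultimately show ?thesis
      by (simp only: distrib_right sum.distrib mult.assoc flip: sum_distrib_left)
  qed
  then show "(\<lambda>x. a * f x + b * g x) \<in> fspan S"
    unfolding fspan_def using f g
    by (intro CollectI exI[of _ "B \<union> B'"] exI[of _ "\<lambda>h. a * (if h \<in> B then c h else 0) + b * (if h \<in> B' then c' h else 0)"]) auto
qed

lemma fspan_mono: "S \<subseteq> T \<Longrightarrow> fspan S \<subseteq> fspan T"
  by (meson fspan_least flin_fspan fspan_superset subset_trans)

lemma fspan_eq: "flin S \<Longrightarrow> fspan S = S"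
  by (simp add: fspan_least fspan_superset subset_antisym)

lemma flin_sums:
  assumes "flin S" "flin T"
  shows "flin {(\<lambda>x. f x + g x) | f g. f \<in> S \<and> g \<in> T}" (is "flin ?P")
  unfolding flin_def
proof (intro conjI ballI allI)
  show "(\<lambda>_. 0) \<in> ?P"
    using assms unfolding flin_def by (intro CollectI exI[of _ "\<lambda>_. 0"]) auto
next
  fix u v a b assume "u \<in> ?P" "v \<in> ?P"
  then obtain f g f' g' where *: "f \<in> S" "g \<in> T" "u = (\<lambda>x. f x + g x)"
    "f' \<in> S" "g' \<in> T" "v = (\<lambda>x. f' x + g' x)" by blast
  then show "(\<lambda>x. a * u x + b * v x) \<in> ?P"
    using flinD[OF assms(1), of f f' a b] flinD[OF assms(2), of g g' a b]
    by (intro CollectI exI[of _ "\<lambda>x. a * f x + b * f' x"] exI[of _ "\<lambda>x. a * g x + b * g' x"])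
      (auto simp: algebra_simps)
qed

text \<open>This unpacks membership in the denominator of \<open>W(G,N)\<close> as an invariant
  homomorphism plus a restricted quasimorphism.\<close>

lemma fspan_Un: "fspan (S \<union> T) = {(\<lambda>x. f x + g x) | f g. f \<in> fspan S \<and> g \<in> fspan T}"
  (is "_ = ?P")
proof
  have "S \<union> T \<subseteq> ?P"
  proof
    fix f assume "f \<in> S \<union> T"
    moreover have "(\<lambda>_. 0) \<in> fspan S" "(\<lambda>_. 0) \<in> fspan T"
      using flin_fspan unfolding flin_def by auto
    ultimately show "f \<in> ?P"
      using fspan_superset[of S] fspan_superset[of T] by (force intro: exI[of _ "\<lambda>_. 0"] exI[of _ f])
  qed
  then show "fspan (S \<union> T) \<subseteq> ?P"
    by (intro fspan_least flin_sums flin_fspan)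
  show "?P \<subseteq> fspan (S \<union> T)"
  proof clarify
    fix f g assume "f \<in> fspan S" "g \<in> fspan T"
    then have "f \<in> fspan (S \<union> T)" "g \<in> fspan (S \<union> T)"
      using fspan_mono[of S "S \<union> T"] fspan_mono[of T "S \<union> T"] by auto
    from flinD[OF flin_fspan this, of 1 1] show "(\<lambda>x. f x + g x) \<in> fspan (S \<union> T)" by simp
  qed
qed

lemma fspan_finite:
  assumes "finite B"
  shows "fspan B = {(\<lambda>x. \<Sum>b\<in>B. c b * b x) | c. True}"
proof
  show "{(\<lambda>x. \<Sum>b\<in>B. c b * b x) | c. True} \<subseteq> fspan B"
    unfolding fspan_def using assms by blast
  show "fspan B \<subseteq> {(\<lambda>x. \<Sum>b\<in>B. c b * b x) | c. True}"
  proof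
    fix f assume "f \<in> fspan B"
    then obtain B' c where B': "finite B'" "B' \<subseteq> B" "f = (\<lambda>x. \<Sum>b\<in>B'. c b * b x)"
      unfolding fspan_def by blast
    have "f x = (\<Sum>b\<in>B. (if b \<in> B' then c b else 0) * b x)" for x
      unfolding B'(3) by (rule sum.mono_neutral_cong_left) (use assms B' in auto)
    then show "f \<in> {(\<lambda>x. \<Sum>b\<in>B. c b * b x) | c. True}"
      by (intro CollectI exI[of _ "\<lambda>b. if b \<in> B' then c b else 0"]) auto
  qed
qed

text \<open>Among the finite sets that generate the quotient, one of least cardinality is a basis: a
  nontrivial relation modulo \<open>U\<close> could be solved for one of its vectors, which could
  then be dropped.\<close>

lemma quot_dim_exists:
  assumes "finite B0" "B0 \<subseteq> fspan V" "V \<subseteq> fspan (B0 \<union> U)"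
  shows "\<exists>n. quot_dim V U n"
proof -
  define P where "P B \<longleftrightarrow> finite B \<and> B \<subseteq> fspan V \<and> V \<subseteq> fspan (B \<union> U)" for B
  have "P B0" using assms by (simp add: P_def)
  then obtain B where B: "P B" and min: "\<And>B'. P B' \<Longrightarrow> card B \<le> card B'"
    using arg_min_nat_lemma[of P B0 card] by blast
  have "indep_mod U B"
    unfolding indep_mod_def
  proof (intro allI impI ballI, rule ccontr)
    fix c b assume c: "(\<lambda>x. \<Sum>b\<in>B. c b * b x) \<in> fspan U" and b: "b \<in> B" and nz: "c b \<noteq> 0"
    let ?S = "fspan (B - {b} \<union> U)"
    have "(\<lambda>x. \<Sum>b\<in>B - {b}. c b * b x) \<in> ?S"
      using B by (intro flin_sum flin_fspan) (use P_def fspan_superset[of "B - {b} \<union> U"] in auto)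
    moreover have "(\<lambda>x. \<Sum>b\<in>B. c b * b x) \<in> ?S"
      using c fspan_mono[of U "B - {b} \<union> U"] by blast
    ultimately have "(\<lambda>x. (1 / c b) * (\<Sum>b\<in>B. c b * b x) + (- 1 / c b) * (\<Sum>b\<in>B - {b}. c b * b x)) \<in> ?S"
      by (intro flinD flin_fspan)
    moreover have "(1 / c b) * (\<Sum>b\<in>B. c b * b x) + (- 1 / c b) * (\<Sum>b\<in>B - {b}. c b * b x) = b x" for x
      using B b nz by (simp add: P_def sum.remove[of B b] field_simps)
    ultimately have "b \<in> ?S" by simp
    then have "B \<union> U \<subseteq> ?S" using fspan_superset[of "B - {b} \<union> U"] by auto
    then have "fspan (B \<union> U) \<subseteq> ?S" by (intro fspan_least flin_fspan)
    then have "P (B - {b})" using B unfolding P_def by auto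
    from min[OF this] show False
      using B b by (metis P_def card_Diff1_less not_le)
  qed
  then show ?thesis using B unfolding P_def quot_dim_def by auto
qed

text \<open>\<open>R\<close> induces an isomorphism of the two quotients, so a basis is carried over
  by choosing a partner for each of its elements. A relation replaces a map because in the
  application neither partner determines the other.\<close>

lemma quot_dim_transfer:
  fixes R :: "('x \<Rightarrow> real) \<Rightarrow> ('y \<Rightarrow> real) \<Rightarrow> bool"
  assumes lin: "\<And>v w v' w' a b. R v w \<Longrightarrow> R v' w' \<Longrightarrow>
      R (\<lambda>x. a * v x + b * v' x) (\<lambda>x. a * w x + b * w' x)"
    and total: "\<And>v. v \<in> fspan V \<Longrightarrow> \<exists>w\<in>fspan V'. R v w"
    and onto: "\<And>w. w \<in> V' \<Longrightarrow> \<exists>v\<in>fspan V. R v w"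
    and iff: "\<And>v w. R v w \<Longrightarrow> v \<in> fspan U \<longleftrightarrow> w \<in> fspan U'"
    and dim: "quot_dim V U n"
  shows "quot_dim V' U' n"
proof -
  obtain B where B: "finite B" "card B = n" "B \<subseteq> fspan V" "V \<subseteq> fspan (B \<union> U)" "indep_mod U B"
    using dim unfolding quot_dim_def by blast
  obtain w0 where w0: "R (\<lambda>_. 0) w0"
    using total[of "\<lambda>_. 0"] flin_fspan unfolding flin_def by blast
  \<comment> \<open>Totality gives only some partner of 0; scaling that pair by 0 makes the partner
    0 as well.\<close>
  have R0: "R (\<lambda>_. 0) (\<lambda>_. 0)" using lin[OF w0 w0, of 0 0] by simp
  from total B(3) have "\<forall>b\<in>B. \<exists>w. w \<in> fspan V' \<and> R b w" by blast
  then obtain F where F: "\<And>b. b \<in> B \<Longrightarrow> F b \<in> fspan V' \<and> R b (F b)"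
    by metis
  have Rsum: "R (\<lambda>x. \<Sum>b\<in>C. c b * b x) (\<lambda>x. \<Sum>b\<in>C. c b * F b x)" if "C \<subseteq> B" for c C
    using finite_subset[OF that B(1)] that
  proof (induction C rule: finite_induct)
    case empty
    then show ?case using R0 by simp
  next
    case (insert b C)
    then show ?case using lin[of b "F b" _ _ "c b" 1] F by fastforce
  qed
  have indep: "\<forall>b\<in>B. c b = 0" if "(\<lambda>x. \<Sum>b\<in>B. c b * F b x) \<in> fspan U'" for c
    using iff[OF Rsum[of B c]] that B(5) unfolding indep_mod_def by blast
  have inj: "inj_on F B"
  proof (rule inj_onI, rule ccontr)
    fix b b' assume b: "b \<in> B" "b' \<in> B" "F b = F b'" "b \<noteq> b'"
    \<comment> \<open>Equal partners of \<open>b\<close> and \<open>b'\<close> would give the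
      relation \<open>F b - F b' = 0\<close>, against independence. Injectivity is what keeps the
      cardinality of the basis.\<close>
    let ?c = "\<lambda>d. if d = b then 1 else if d = b' then - 1 else 0 :: real"
    have "(\<Sum>d\<in>B. ?c d * F d x) = (\<Sum>d\<in>{b,b'}. ?c d * F d x)" for x
      by (rule sum.mono_neutral_right) (use b B in auto)
    then have "(\<Sum>d\<in>B. ?c d * F d x) = 0" for x using b by simp
    then have "(\<lambda>x. \<Sum>d\<in>B. ?c d * F d x) \<in> fspan U'"
      using flin_fspan[of U'] unfolding flin_def by simp
    from indep[OF this] b show False by force
  qed
  have "indep_mod U' (F ` B)"
    unfolding indep_mod_def
  proof (intro allI impI)
    fix c assume "(\<lambda>x. \<Sum>b\<in>F ` B. c b * b x) \<in> fspan U'"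
    then have "(\<lambda>x. \<Sum>b\<in>B. c (F b) * F b x) \<in> fspan U'"
      by (simp add: sum.reindex[OF inj])
    from indep[OF this] show "\<forall>b\<in>F ` B. c b = 0" by blast
  qed
  moreover have "V' \<subseteq> fspan (F ` B \<union> U')"
  proof
    fix w assume "w \<in> V'"
    then obtain v where v: "v \<in> fspan V" "R v w" using onto by blast
    have "v \<in> fspan (B \<union> U)" using v B(4) fspan_least[OF flin_fspan] by blast
    then obtain c u where u: "u \<in> fspan U" "v = (\<lambda>x. (\<Sum>b\<in>B. c b * b x) + u x)"
      unfolding fspan_Un fspan_finite[OF B(1)] by blast
    let ?w = "\<lambda>x. 1 * w x + (- 1) * (\<Sum>b\<in>B. c b * F b x)"
    have "R (\<lambda>x. 1 * v x + (- 1) * (\<Sum>b\<in>B. c b * b x)) ?w"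
      by (intro lin v Rsum) auto
    then have "R u ?w" by (simp add: u(2))
    then have "?w \<in> fspan U'" using iff u by blast
    then have "?w \<in> fspan (F ` B \<union> U')" using fspan_mono[of U' "F ` B \<union> U'"] by blast
    moreover have "(\<lambda>x. \<Sum>b\<in>B. c b * F b x) \<in> fspan (F ` B \<union> U')"
      by (intro flin_sum flin_fspan B) (use fspan_superset[of "F ` B \<union> U'"] in auto)
    ultimately have "(\<lambda>x. 1 * ?w x + 1 * (\<Sum>b\<in>B. c b * F b x)) \<in> fspan (F ` B \<union> U')"
      by (rule flinD[OF flin_fspan])
    then show "w \<in> fspan (F ` B \<union> U')" by simp
  qed
  ultimately show ?thesis
    unfolding quot_dim_def using B F card_image[OF inj] by (intro exI[of _ "F ` B"]) auto
qed

text \<open>If the values on a finite set determine the functions in a linear space, they do so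
  through linear interpolation. In the induction, the functions that vanish at \<open>t\<close> are
  handled by the hypothesis, and at most one further direction remains.\<close>

lemma dual_family_exists:
  assumes "finite T" "flin S" "\<And>f. f \<in> S \<Longrightarrow> (\<forall>t\<in>T. f t = 0) \<Longrightarrow> f = (\<lambda>_. 0)"
  shows "\<exists>e. (\<forall>t\<in>T. e t \<in> S) \<and> (\<forall>f\<in>S. f = (\<lambda>x. \<Sum>t\<in>T. f t * e t x))"
  using assms
proof (induction T arbitrary: S rule: finite_induct)
  case empty
  then show ?case by auto
next
  case (insert t T)
  let ?S = "{f \<in> S. f t = 0}"
  have "flin ?S" using insert.prems(1) unfolding flin_def by auto
  moreover have "f = (\<lambda>_. 0)" if "f \<in> ?S" "\<forall>t\<in>T. f t = 0" for f
    using insert.prems(2) that by auto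
  ultimately obtain e where e: "\<forall>t\<in>T. e t \<in> ?S" "\<forall>f\<in>?S. f = (\<lambda>x. \<Sum>t\<in>T. f t * e t x)"
    using insert.IH[of ?S] by blast
  show ?case
  proof (cases "\<forall>f\<in>S. f t = 0")
    case True
    let ?e = "e(t := \<lambda>_. 0)"
    have "\<forall>s\<in>insert t T. ?e s \<in> S"
      using e(1) insert.prems(1) unfolding flin_def by auto
    moreover have "f = (\<lambda>x. \<Sum>s\<in>insert t T. f s * ?e s x)" if "f \<in> S" for f
    proof
      fix x
      have "f x = (\<Sum>s\<in>T. f s * e s x)"
        by (rule fun_cong[OF bspec[OF e(2)]]) (use that True in simp)
      also have "\<dots> = (\<Sum>s\<in>T. f s * ?e s x)"
        by (rule sum.cong) (use insert in auto)
      also have "\<dots> = (\<Sum>s\<in>insert t T. f s * ?e s x)" using insert.hyps by simp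
      finally show "f x = (\<Sum>s\<in>insert t T. f s * ?e s x)" .
    qed
    ultimately show ?thesis by blast
  next
    case False
    then obtain f0 where f0: "f0 \<in> S" "f0 t \<noteq> 0" by blast
    define u where "u = (\<lambda>x. (1 / f0 t) * f0 x + 0 * f0 x)"
    have u: "u \<in> S" "u t = 1"
      unfolding u_def by (intro flinD insert.prems f0) (use f0 in simp)
    \<comment> \<open>Interpolating \<open>f - f t * u\<close>, which vanishes at \<open>t\<close>,
      and solving for \<open>f\<close> leaves exactly \<open>v\<close> as the coefficient function
      of \<open>f t\<close>.\<close>
    define v where "v = (\<lambda>x. 1 * u x + (- 1) * (\<Sum>s\<in>T. u s * e s x))"
    have v: "v \<in> S" unfolding v_def
      by (intro flinD[OF insert.prems(1)] u flin_sum insert) (use e in auto)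
    let ?e = "e(t := v)"
    have "\<forall>s\<in>insert t T. ?e s \<in> S"
      using e(1) v by auto
    moreover have "f = (\<lambda>x. \<Sum>s\<in>insert t T. f s * ?e s x)" if "f \<in> S" for f
    proof
      fix x
      let ?f = "\<lambda>x. 1 * f x + (- f t) * u x"
      have "?f \<in> S" by (intro flinD insert.prems that u)
      then have "?f \<in> ?S" using u(2) by simp
      with e(2) have "?f = (\<lambda>x. \<Sum>s\<in>T. ?f s * e s x)" by (rule bspec)
      then have "?f x = (\<Sum>s\<in>T. ?f s * e s x)" by (rule fun_cong)
      also have "\<dots> = (\<Sum>s\<in>T. f s * e s x) - f t * (\<Sum>s\<in>T. u s * e s x)"
        by (simp add: left_diff_distrib sum_subtractf sum_distrib_left mult.assoc)
      finally have "f x = (\<Sum>s\<in>T. f s * e s x) + f t * v x"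
        by (simp add: v_def algebra_simps)
      moreover have "(\<Sum>s\<in>T. f s * ?e s x) = (\<Sum>s\<in>T. f s * e s x)"
        by (rule sum.cong) (use insert in auto)
      moreover have "(\<Sum>s\<in>insert t T. f s * ?e s x) = f t * v x + (\<Sum>s\<in>T. f s * ?e s x)"
        using insert.hyps by simp
      ultimately show "f x = (\<Sum>s\<in>insert t T. f s * ?e s x)" by linarith
    qed
    ultimately show ?thesis by blast
  qed
qed

section \<open>Homogenization\<close>

text \<open>The device that turns equations up to a bounded error into exact ones: scale the defect
  by \<open>n\<close> while the error stays fixed.\<close>

lemma bounded_multiples_zero:
  fixes a :: real
  assumes "\<And>n::nat. \<bar>real n * a\<bar> \<le> C"
  shows "a = 0"
proof (rule ccontr)
  assume "a \<noteq> 0"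
  then obtain n :: nat where "C < real n * \<bar>a\<bar>"
    using reals_Archimedean3[of "\<bar>a\<bar>"] by auto
  with assms[of n] show False by (simp add: abs_mult)
qed

text \<open>The slope \<open>L\<close> exists because every lower estimate
  \<open>(u m - D) / m\<close> lies below every upper estimate \<open>(u n + D) / n\<close>; the
  supremum of the lower ones separates the two families and keeps the constant
  \<open>D\<close>.\<close>

lemma almost_additive_nat:
  fixes u :: "nat \<Rightarrow> real"
  assumes "\<And>m n. \<bar>u (m + n) - u m - u n\<bar> \<le> D"
  shows "\<exists>L. \<forall>n. \<bar>u n - real n * L\<bar> \<le> D"
proof -
  have mult: "\<bar>u (Suc m * n) - real (Suc m) * u n\<bar> \<le> real m * D" for m n
  proof (induction m)
    case (Suc m)
    then show ?case using assms[of n "Suc m * n"] by (simp add: algebra_simps abs_le_iff)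
  qed simp
  \<comment> \<open>Estimate \<open>u (m * n)\<close> in two ways, as an \<open>m\<close>-fold and
    as an \<open>n\<close>-fold multiple.\<close>
  have cmp: "(u m - D) / real m \<le> (u n + D) / real n" if "m > 0" "n > 0" for m n
  proof -
    obtain k l where kl: "m = Suc k" "n = Suc l" using \<open>m > 0\<close> \<open>n > 0\<close> gr0_conv_Suc by auto
    have "real n * u m - real l * D \<le> real m * u n + real k * D"
      using mult[of k n] mult[of l m] unfolding kl by (simp add: mult.commute abs_le_iff)
    then have "real n * (u m - D) \<le> real m * (u n + D)"
      using assms[of 0 0] by (simp add: kl algebra_simps)
    then show ?thesis using that by (simp add: field_simps)
  qed
  define L where "L = (SUP m\<in>{0<..}. (u m - D) / real m)"
  have "\<bar>u n - real n * L\<bar> \<le> D" for n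
  proof (cases "n = 0")
    case True
    then show ?thesis using assms[of 0 0] by simp
  next
    case False
    have "L \<le> (u n + D) / real n"
      unfolding L_def using False cmp by (intro cSUP_least) auto
    moreover have "(u n - D) / real n \<le> L"
      unfolding L_def using False cmp by (intro cSUP_upper bdd_aboveI2[of _ _ "(u n + D) / real n"]) auto
    ultimately show ?thesis using False by (simp add: field_simps abs_le_iff)
  qed
  then show ?thesis by blast
qed

text \<open>The slopes along the positive and the negative integers are opposite, since
  \<open>u n + u (- n)\<close> stays bounded.\<close>

lemma almost_additive_int:
  fixes u :: "int \<Rightarrow> real"
  assumes "\<And>i j. \<bar>u (i + j) - u i - u j\<bar> \<le> D"
  shows "\<exists>L. \<forall>i. \<bar>u i - of_int i * L\<bar> \<le> D"
proof -
  obtain L where L: "\<And>n::nat. \<bar>u (int n) - real n * L\<bar> \<le> D"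
    using almost_additive_nat[of "\<lambda>n. u (int n)" D] assms by (metis of_nat_add)
  obtain L' where L': "\<And>n::nat. \<bar>u (- int n) - real n * L'\<bar> \<le> D"
    using almost_additive_nat[of "\<lambda>n. u (- int n)" D] assms by (metis of_nat_add minus_add_distrib)
  have "\<bar>real n * (L + L')\<bar> \<le> 4 * D" for n
    using L[of n] L'[of n] assms[of "int n" "- int n"] assms[of 0 0]
    by (simp add: distrib_left abs_le_iff)
  then have "L' = - L" using bounded_multiples_zero[of "L + L'"] by fastforce
  then have "\<bar>u i - of_int i * L\<bar> \<le> D" for i
    using L[of "nat i"] L'[of "nat (- i)"] by (cases "i \<ge> 0") (auto simp: of_nat_nat)
  then show ?thesis by blast
qed

lemma abs_linear_bound:
  fixes a b c d u v :: real
  assumes "\<bar>u\<bar> \<le> c" "\<bar>v\<bar> \<le> d"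
  shows "\<bar>a * u + b * v\<bar> \<le> \<bar>a\<bar> * c + \<bar>b\<bar> * d"
proof -
  have "\<bar>a * u + b * v\<bar> \<le> \<bar>a\<bar> * \<bar>u\<bar> + \<bar>b\<bar> * \<bar>v\<bar>"
    by (metis abs_mult abs_triangle_ineq)
  also have "\<dots> \<le> \<bar>a\<bar> * c + \<bar>b\<bar> * d" using assms by (intro add_mono mult_left_mono) auto
  finally show ?thesis .
qed

context group
begin

lemma inv_cancel_left [simp]:
  assumes "x \<in> carrier G" "y \<in> carrier G"
  shows "x \<otimes> (inv x \<otimes> y) = y" "inv x \<otimes> (x \<otimes> y) = y"
  using assms by (simp_all flip: m_assoc)

lemma real_hom_one:
  assumes "subgroup H G" "real_hom G H f"
  shows "f \<one> = 0"
proof -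
  have "\<one> \<in> H" using assms(1) by (rule subgroup.one_closed)
  then have "f (\<one> \<otimes> \<one>) = f \<one> + f \<one>" using assms(2) unfolding real_hom_def by blast
  then show ?thesis by simp
qed

lemma real_hom_inv:
  assumes "subgroup H G" "real_hom G H f" "x \<in> H"
  shows "f (inv x) = - f x"
proof -
  have "x \<in> carrier G" "inv x \<in> H" using assms by (auto intro: subgroup.mem_carrier subgroup.m_inv_closed)
  then have "f (x \<otimes> inv x) = f x + f (inv x)" using assms unfolding real_hom_def by blast
  then show ?thesis using real_hom_one[OF assms(1,2)] \<open>x \<in> carrier G\<close> by simp
qed

lemma real_hom_nat_pow:
  assumes "subgroup H G" "real_hom G H f" "x \<in> H"
  shows "f (x [^] (n::nat)) = real n * f x"
proof (induction n)
  case 0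
  then show ?case using real_hom_one[OF assms(1,2)] by simp
next
  case (Suc n)
  have "x [^] n \<in> H"
    using subgroup_int_pow_closed[OF assms(1,3), of "int n"] by (simp add: int_pow_int)
  then have "f (x [^] n \<otimes> x) = f (x [^] n) + f x" using assms unfolding real_hom_def by blast
  then show ?case using Suc by (simp add: algebra_simps)
qed

lemma real_hom_int_pow:
  assumes "subgroup H G" "real_hom G H f" "x \<in> H"
  shows "f (x [^] (n::int)) = of_int n * f x"
proof -
  have "x [^] k \<in> H" for k :: nat
    using subgroup_int_pow_closed[OF assms(1,3), of "int k"] by (simp only: int_pow_int)
  then have "f (inv (x [^] k)) = - (real k * f x)" for k :: nat
    using real_hom_inv[OF assms(1,2)] real_hom_nat_pow[OF assms] by simp
  moreover have "x [^] (- int k) = inv (x [^] k)" for k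
    using subgroup.mem_carrier[OF assms(1,3)] by (rule int_pow_neg_int)
  ultimately have pow_neg: "f (x [^] (- int k)) = - (real k * f x)" for k
    by simp
  show ?thesis
  proof (cases n)
    case (nonneg k)
    then show ?thesis using real_hom_nat_pow[OF assms, of k] by (simp add: int_pow_int)
  next
    case (neg k)
    then show ?thesis using pow_neg[of "Suc k"] by (simp only: of_int_minus of_int_of_nat_eq mult_minus_left)
  qed
qed

text \<open>By homogeneity the difference at \<open>x [^] n\<close> grows linearly in
  \<open>n\<close>, so a bound along the powers of \<open>x\<close> forces equality at
  \<open>x\<close>.\<close>

lemma homogeneous_cong:
  fixes f g :: "'a \<Rightarrow> real"
  assumes "\<And>n::int. f (x [^] n) = of_int n * f x" "\<And>n::int. g (x [^] n) = of_int n * g x"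
    and "\<And>n::int. \<bar>f (x [^] n) - g (x [^] n)\<bar> \<le> C"
  shows "f x = g x"
proof -
  have "\<bar>real n * (f x - g x)\<bar> \<le> C" for n
    using assms(3)[of "int n"] by (simp add: assms(1,2) right_diff_distrib)
  then show ?thesis using bounded_multiples_zero by fastforce
qed

text \<open>The value of \<Phi> at \<open>x\<close> is the slope of \<open>F\<close> along the
  powers of \<open>x\<close>. The hypothesis concerns one cyclic subgroup at a time, so it also
  covers primitives of antisymmetric forms, which need not be quasimorphisms.\<close>

lemma homogenization_exists:
  fixes F :: "'a \<Rightarrow> real"
  assumes K: "subgroup K G"
    and F: "\<And>x i j. x \<in> K \<Longrightarrow> \<bar>F (x [^] (i + j :: int)) - F (x [^] i) - F (x [^] j)\<bar> \<le> D"
  shows "\<exists>\<Phi>. (\<forall>x. x \<notin> K \<longrightarrow> \<Phi> x = 0) \<and> (\<forall>x\<in>K. \<bar>F x - \<Phi> x\<bar> \<le> D) \<and>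
    (\<forall>x\<in>K. \<forall>n::int. \<Phi> (x [^] n) = of_int n * \<Phi> x)"
proof -
  have "\<exists>L. \<forall>i. \<bar>F (x [^] i) - of_int i * L\<bar> \<le> D" if "x \<in> K" for x
    using almost_additive_int[of "\<lambda>i. F (x [^] i)" D] F that by blast
  then obtain L where L: "\<And>x i. x \<in> K \<Longrightarrow> \<bar>F (x [^] (i::int)) - of_int i * L x\<bar> \<le> D"
    by metis
  have hom: "L (x [^] n) = of_int n * L x" if x: "x \<in> K" for x and n :: int
  proof -
    have xc: "x \<in> carrier G" using K x by (rule subgroup.mem_carrier)
    have xn: "x [^] n \<in> K" using subgroup_int_pow_closed[OF K x] .
    have "\<bar>real i * (L (x [^] n) - of_int n * L x)\<bar> \<le> 2 * D" for i
      using L[OF xn, of "int i"] L[OF x, of "n * int i"] int_pow_pow[OF xc, of n "int i"]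
      by (simp add: algebra_simps abs_le_iff)
    then show ?thesis using bounded_multiples_zero by fastforce
  qed
  have "\<bar>F x - L x\<bar> \<le> D" if "x \<in> K" for x
    using L[OF that, of 1] subgroup.mem_carrier[OF K that] by simp
  then show ?thesis
    using hom subgroup_int_pow_closed[OF K]
    by (intro exI[of _ "\<lambda>x. if x \<in> K then L x else 0"]) simp
qed

definition commut :: "'a \<Rightarrow> 'a \<Rightarrow> 'a" where
  "commut x y = x \<otimes> y \<otimes> inv x \<otimes> inv y"

text \<open>A conjugation-invariant function does not see the conjugation by \<open>x\<close>, so
  this makes its value on commutators additive, or almost additive, in the first entry.\<close>

lemma commut_mult_left:
  assumes "x \<in> carrier G" "x' \<in> carrier G" "y \<in> carrier G"
  shows "commut (x \<otimes> x') y = (x \<otimes> commut x' y \<otimes> inv x) \<otimes> commut x y"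
  using assms by (simp add: commut_def m_assoc inv_mult_group)

lemma inv_commut:
  assumes "x \<in> carrier G" "y \<in> carrier G"
  shows "inv (commut x y) = commut y x"
  using assms by (simp add: commut_def m_assoc inv_mult_group)

lemma commut_mult:
  assumes "x \<in> carrier G" "y \<in> carrier G"
  shows "commut x y \<otimes> (y \<otimes> x) = x \<otimes> y"
proof -
  have "commut x y \<otimes> (y \<otimes> x) = x \<otimes> (y \<otimes> (inv x \<otimes> (inv y \<otimes> (y \<otimes> x))))"
    using assms by (simp only: commut_def m_assoc m_closed inv_closed)
  then show ?thesis using assms by simp
qed

end

section \<open>Characters and bilinear forms that vanish on \<open>N\<close>\<close>

locale abelian_quotient = normal N G for N and G (structure) +
  assumes commut_in: "x \<in> carrier G \<Longrightarrow> y \<in> carrier G \<Longrightarrow> commut x y \<in> N"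
begin

lemma N_subgroup: "subgroup N G"
  by (rule subgroup_axioms)

text \<open>A description without cosets of the image of H^1(G/N) in H^1(G); see
  \<open>pullH1_eq_chars\<close>.\<close>

definition chars :: "('a \<Rightarrow> real) set" where
  "chars = {a. real_hom G (carrier G) a \<and> (\<forall>x\<in>N. a x = 0)}"

lemma chars_mult: "a \<in> chars \<Longrightarrow> x \<in> carrier G \<Longrightarrow> y \<in> carrier G \<Longrightarrow> a (x \<otimes> y) = a x + a y"
  by (simp add: chars_def real_hom_def)

lemma chars_inv: "a \<in> chars \<Longrightarrow> x \<in> carrier G \<Longrightarrow> a (inv x) = - a x"
  using real_hom_inv[OF subgroup_self] by (simp add: chars_def)

lemma chars_int_pow: "a \<in> chars \<Longrightarrow> x \<in> carrier G \<Longrightarrow> a (x [^] (n::int)) = of_int n * a x"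
  using real_hom_int_pow[OF subgroup_self] by (simp add: chars_def)

lemma chars_nat_pow: "a \<in> chars \<Longrightarrow> x \<in> carrier G \<Longrightarrow> a (x [^] (n::nat)) = real n * a x"
  using real_hom_nat_pow[OF subgroup_self] by (simp add: chars_def)

lemma chars_N: "a \<in> chars \<Longrightarrow> x \<in> N \<Longrightarrow> a x = 0"
  by (simp add: chars_def)

lemma chars_outside: "a \<in> chars \<Longrightarrow> x \<notin> carrier G \<Longrightarrow> a x = 0"
  by (simp add: chars_def real_hom_def)

text \<open>The arguments range over the whole type, and \<open>chars\<close> prescribes 0 outside
  \<open>G\<close>. Forms are thereby equal as functions, as the identification with the span of the
  cup products in \<open>fspan_cups\<close> requires.\<close>

definition bilin :: "('a \<times> 'a \<Rightarrow> real) \<Rightarrow> bool" where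
  "bilin w \<longleftrightarrow> (\<forall>x. (\<lambda>y. w (x, y)) \<in> chars) \<and> (\<forall>y. (\<lambda>x. w (x, y)) \<in> chars)"

lemma bilinD: "bilin w \<Longrightarrow> (\<lambda>y. w (x, y)) \<in> chars" "bilin w \<Longrightarrow> (\<lambda>x. w (x, y)) \<in> chars"
  by (simp_all add: bilin_def)

text \<open>Cited by position below: odd entries act on the second argument of \<open>w\<close>,
  even ones on the first. The pairs are products, inverses, integer powers, natural powers,
  vanishing on \<open>N\<close> and vanishing outside \<open>G\<close>.\<close>

lemmas bilin_simps =
  chars_mult[OF bilinD(1)] chars_mult[OF bilinD(2)]
  chars_inv[OF bilinD(1)] chars_inv[OF bilinD(2)]
  chars_int_pow[OF bilinD(1)] chars_int_pow[OF bilinD(2)]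
  chars_nat_pow[OF bilinD(1)] chars_nat_pow[OF bilinD(2)]
  chars_N[OF bilinD(1)] chars_N[OF bilinD(2)]
  chars_outside[OF bilinD(1)] chars_outside[OF bilinD(2)]

lemma flin_chars: "flin chars"
  unfolding flin_def chars_def real_hom_def by (auto simp: algebra_simps)

text \<open>The sign convention is that of \<open>cobound1\<close>: the bounded quantity is
  \<open>w - cobound1 G \<phi>\<close>.\<close>

definition bounded_primitive :: "('a \<times> 'a \<Rightarrow> real) \<Rightarrow> ('a \<Rightarrow> real) \<Rightarrow> bool" where
  "bounded_primitive w \<phi> \<longleftrightarrow>
    (\<exists>D. \<forall>x\<in>carrier G. \<forall>y\<in>carrier G. \<bar>\<phi> (x \<otimes> y) - \<phi> x - \<phi> y + w (x, y)\<bar> \<le> D)"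

text \<open>Induction with \<open>commut_mult_left\<close>: conjugation invariance removes the
  conjugation and additivity of \<open>h\<close> splits the product.\<close>

lemma real_hom_commut_pow:
  assumes h: "real_hom G N h" "conj_inv G N h" and x: "x \<in> carrier G" and y: "y \<in> carrier G"
  shows "h (commut (x [^] (n::nat)) y) = real n * h (commut x y)"
proof (induction n)
  case 0
  then show ?case using y real_hom_one[OF N_subgroup h(1)] by (simp add: commut_def)
next
  case (Suc n)
  let ?c = "x [^] n \<otimes> commut x y \<otimes> inv (x [^] n)"
  have "commut x y \<in> N" "commut (x [^] n) y \<in> N" using x y commut_in by auto
  moreover from this have "?c \<in> N" "h ?c = h (commut x y)"
    using inv_op_closed2 h(2) x unfolding conj_inv_def by auto
  ultimately have "h (?c \<otimes> commut (x [^] n) y) = h (commut x y) + h (commut (x [^] n) y)"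
    using h(1) unfolding real_hom_def by metis
  then show ?case using Suc commut_mult_left[of "x [^] n" x y] x y by (simp add: algebra_simps)
qed

text \<open>Expand \<open>\<Phi> ((x y)\<^sup>n)\<close> via \<open>(x y)\<^sup>n = c\<^sub>n x\<^sup>n y\<^sup>n\<close>, where \<open>\<Phi> c\<^sub>n = n (n - 1) w (x, y)\<close>:
  the quadratic terms cancel, and dividing by \<open>n\<close> removes the bounded error.\<close>
lemma homogeneous_primitive_exact:
  assumes w: "bilin w" and anti: "\<And>x y. w (y, x) = - w (x, y)"
    and prim: "bounded_primitive w \<Phi>"
    and homog: "\<And>x n. x \<in> carrier G \<Longrightarrow> \<Phi> (x [^] (n::int)) = of_int n * \<Phi> x"
    and h: "real_hom G N h" "conj_inv G N h" and \<Phi>h: "\<And>x. x \<in> N \<Longrightarrow> \<Phi> x = h x"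
    and x: "x \<in> carrier G" and y: "y \<in> carrier G"
  shows "\<Phi> (x \<otimes> y) = \<Phi> x + \<Phi> y - w (x, y)"
proof -
  obtain D where D: "\<And>x y. x \<in> carrier G \<Longrightarrow> y \<in> carrier G \<Longrightarrow> \<bar>\<Phi> (x \<otimes> y) - \<Phi> x - \<Phi> y + w (x, y)\<bar> \<le> D"
    using prim unfolding bounded_primitive_def by blast
  have homog_nat: "\<Phi> (z [^] (n::nat)) = real n * \<Phi> z" if "z \<in> carrier G" for z n
    using homog[OF that, of "int n"] by (simp add: int_pow_int)
  \<comment> \<open>Compare \<Phi> on both sides of
    \<open>u \<otimes> v = commut u v \<otimes> (v \<otimes> u)\<close>. The form contributes
    \<open>w (u, v) - w (v, u) = 2 * w (u, v)\<close>, and it vanishes on pairs containing the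
    commutator.\<close>
  have close: "\<bar>h (commut u v) + 2 * w (u, v)\<bar> \<le> 3 * D" if u: "u \<in> carrier G" and v: "v \<in> carrier G" for u v
  proof -
    have c: "commut u v \<in> N" "commut u v \<in> carrier G" using commut_in[OF u v] by auto
    show ?thesis
      using D[OF u v] D[OF v u] D[OF c(2), of "v \<otimes> u"] commut_mult[OF u v] u v \<Phi>h[OF c(1)]
        bilin_simps(10)[OF w c(1)] anti[of u v] by (simp add: abs_le_iff)
  qed
  \<comment> \<open>Replacing \<open>u\<close> by \<open>u [^] n\<close> multiplies both terms by
    \<open>n\<close>, so the bounded error disappears.\<close>
  have hc: "h (commut u v) = - 2 * w (u, v)" if u: "u \<in> carrier G" and v: "v \<in> carrier G" for u v
  proof -
    have "\<bar>real n * (h (commut u v) + 2 * w (u, v))\<bar> \<le> 3 * D" for n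
      using close[of "u [^] n" v] u v real_hom_commut_pow[OF h u v, of n] bilin_simps(8)[OF w u]
      by (simp add: algebra_simps)
    then show ?thesis using bounded_multiples_zero[of "h (commut u v) + 2 * w (u, v)"] by fastforce
  qed
  define c where "c n = (x \<otimes> y) [^] n \<otimes> inv (y [^] n) \<otimes> inv (x [^] n)" for n :: nat
  have c_mult: "(x \<otimes> y) [^] n = c n \<otimes> (x [^] n \<otimes> y [^] n)" for n
    using x y by (simp add: c_def m_assoc)
  have c: "c n \<in> N \<and> h (c n) = real n * (real n - 1) * w (x, y)" for n
  proof (induction n)
    case 0
    then show ?case using real_hom_one[OF N_subgroup h(1)] by (simp add: c_def)
  next
    case (Suc n)
    let ?d = "commut (y [^] n) x" and ?z = "x [^] n"
    \<comment> \<open>Moving the new factor \<open>x\<close> to the left past \<open>y [^] n\<close>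
      costs the commutator \<open>?d\<close>, conjugated by \<open>x [^] n\<close>.\<close>
    have "c (Suc n) = c n \<otimes> (?z \<otimes> ?d \<otimes> inv ?z)"
      using x y by (simp add: c_def commut_def m_assoc inv_mult_group)
    moreover have d: "?d \<in> N" using x y commut_in by simp
    moreover have "?z \<otimes> ?d \<otimes> inv ?z \<in> N" "h (?z \<otimes> ?d \<otimes> inv ?z) = h ?d"
      using inv_op_closed2 h(2) x d unfolding conj_inv_def by auto
    ultimately have "c (Suc n) \<in> N" "h (c (Suc n)) = h (c n) + h ?d"
      using Suc h(1) unfolding real_hom_def by auto
    moreover have "h ?d = 2 * real n * w (x, y)"
      using hc[of "y [^] n" x] x y bilin_simps(8)[OF w y] anti[of x y] by simp
    ultimately show ?case using Suc by (simp add: algebra_simps)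
  qed
  have "\<bar>real n * (\<Phi> (x \<otimes> y) - \<Phi> x - \<Phi> y + w (x, y))\<bar> \<le> 2 * D" for n
  proof -
    have cn: "c n \<in> carrier G" using c by auto
    have xn: "x [^] n \<in> carrier G" and yn: "y [^] n \<in> carrier G" using x y by auto
    have "w (c n, x [^] n \<otimes> y [^] n) = 0" using c bilin_simps(10)[OF w] by blast
    then have "\<bar>\<Phi> ((x \<otimes> y) [^] n) - h (c n) - \<Phi> (x [^] n \<otimes> y [^] n)\<bar> \<le> D"
      using D[OF cn, of "x [^] n \<otimes> y [^] n"] xn yn c_mult[of n] c[of n] \<Phi>h[of "c n"] by simp
    moreover have "w (x [^] n, y [^] n) = real n * real n * w (x, y)"
      using x y w by (simp add: bilin_simps)
    ultimately show ?thesis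
      using D[OF xn yn] homog_nat[of x n] homog_nat[of y n] homog_nat[of "x \<otimes> y" n] x y c[of n]
      by (simp add: algebra_simps abs_le_iff)
  qed
  then show ?thesis
    using bounded_multiples_zero[of "\<Phi> (x \<otimes> y) - \<Phi> x - \<Phi> y + w (x, y)"] by fastforce
qed

end

section \<open>Linear spaces behind the two quotients, and homogenization of quasimorphisms\<close>

context group
begin

lemma flin_hom_qm: "flin {f. hom_qm G H f}"
  unfolding flin_def
proof (intro conjI ballI allI)
  show "(\<lambda>_. 0) \<in> {f. hom_qm G H f}" by (auto simp: hom_qm_def)
next
  fix f g a b assume "f \<in> {f. hom_qm G H f}" "g \<in> {f. hom_qm G H f}"
  then have fg: "hom_qm G H f" "hom_qm G H g" by simp_all
  have f: "\<And>x. x \<notin> H \<Longrightarrow> f x = 0" "\<And>x n. x \<in> H \<Longrightarrow> f (x [^] (n::int)) = of_int n * f x"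
    using fg(1) by (simp_all add: hom_qm_def)
  obtain D where D: "\<And>x y. x \<in> H \<Longrightarrow> y \<in> H \<Longrightarrow> \<bar>f (x \<otimes> y) - f x - f y\<bar> \<le> D"
    using fg(1) unfolding hom_qm_def by blast
  have g: "\<And>x. x \<notin> H \<Longrightarrow> g x = 0" "\<And>x n. x \<in> H \<Longrightarrow> g (x [^] (n::int)) = of_int n * g x"
    using fg(2) by (simp_all add: hom_qm_def)
  obtain D' where D': "\<And>x y. x \<in> H \<Longrightarrow> y \<in> H \<Longrightarrow> \<bar>g (x \<otimes> y) - g x - g y\<bar> \<le> D'"
    using fg(2) unfolding hom_qm_def by blast
  let ?u = "\<lambda>x. a * f x + b * g x"
  have "\<bar>?u (x \<otimes> y) - ?u x - ?u y\<bar> \<le> \<bar>a\<bar> * D + \<bar>b\<bar> * D'" if "x \<in> H" "y \<in> H" for x y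
  proof -
    have "?u (x \<otimes> y) - ?u x - ?u y = a * (f (x \<otimes> y) - f x - f y) + b * (g (x \<otimes> y) - g x - g y)"
      by (simp add: algebra_simps)
    also have "\<bar>\<dots>\<bar> \<le> \<bar>a\<bar> * D + \<bar>b\<bar> * D'"
      by (intro abs_linear_bound D D' that)
    finally show ?thesis .
  qed
  then show "?u \<in> {f. hom_qm G H f}"
    unfolding hom_qm_def using f g by (auto simp: distrib_left mult.left_commute)
qed

lemma flin_conj_inv: "flin {f. conj_inv G N f}"
  unfolding flin_def conj_inv_def by auto

lemma flin_real_hom: "flin {f. real_hom G H f}"
  unfolding flin_def real_hom_def by (auto simp: algebra_simps)

lemma flin_Int: "flin S \<Longrightarrow> flin T \<Longrightarrow> flin (S \<inter> T)"
  unfolding flin_def by auto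

lemma flin_QNG: "flin (QNG G N)"
  using flin_Int[OF flin_hom_qm flin_conj_inv] unfolding QNG_def by (simp add: Collect_conj_eq)

lemma flin_H1NG: "flin (H1NG G N)"
  using flin_Int[OF flin_real_hom flin_conj_inv] unfolding H1NG_def by (simp add: Collect_conj_eq)

lemma flin_QG_restr: "flin (QG_restr G N)"
  unfolding flin_def
proof (intro conjI ballI allI)
  show "(\<lambda>_. 0) \<in> QG_restr G N"
    using flin_hom_qm[of "carrier G"] unfolding flin_def QG_restr_def
    by (intro CollectI exI[of _ "\<lambda>_. 0"]) auto
next
  fix f g a b assume "f \<in> QG_restr G N" "g \<in> QG_restr G N"
  then obtain u v where "hom_qm G (carrier G) u" "hom_qm G (carrier G) v"
    "f = (\<lambda>x. if x \<in> N then u x else 0)" "g = (\<lambda>x. if x \<in> N then v x else 0)"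
    unfolding QG_restr_def by blast
  then show "(\<lambda>x. a * f x + b * g x) \<in> QG_restr G N"
    using flinD[OF flin_hom_qm[of "carrier G"], of u v a b] unfolding QG_restr_def
    by (intro CollectI exI[of _ "\<lambda>x. a * u x + b * v x"]) auto
qed

lemma flin_B2: "flin (B2 G)"
  unfolding flin_def
proof (intro conjI ballI allI)
  have "(\<lambda>_. 0) = cobound1 G (\<lambda>_. 0)" by (auto simp: cobound1_def)
  then show "(\<lambda>_. 0) \<in> B2 G" unfolding B2_def by blast
next
  fix f g a b assume "f \<in> B2 G" "g \<in> B2 G"
  then obtain u v where "f = cobound1 G u" "g = cobound1 G v"
    unfolding B2_def by blast
  then have "(\<lambda>x. a * f x + b * g x) = cobound1 G (\<lambda>x. a * u x + b * v x)"
    by (auto simp: cobound1_def algebra_simps)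
  then show "(\<lambda>x. a * f x + b * g x) \<in> B2 G" unfolding B2_def by blast
qed

lemma int_pow_conj:
  assumes "g \<in> carrier G" "x \<in> carrier G"
  shows "(g \<otimes> x \<otimes> inv g) [^] (n::int) = g \<otimes> x [^] n \<otimes> inv g"
proof -
  have nat: "(g \<otimes> x \<otimes> inv g) [^] (n::nat) = g \<otimes> x [^] n \<otimes> inv g" for n
    by (induction n) (use assms in \<open>simp_all add: m_assoc\<close>)
  have "(g \<otimes> x \<otimes> inv g) [^] (- int n) = g \<otimes> x [^] (- int n) \<otimes> inv g" for n
    using assms by (simp add: int_pow_neg_int nat) (simp add: inv_mult_group m_assoc)
  then show ?thesis
    by (cases n) (metis nat int_pow_int, metis)
qed

text \<open>Since \<Phi> stays within \<open>D\<close> of \<open>F\<close>, and a defect involves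
  three values, the defect of \<Phi> is at most \<open>4 * D\<close>.\<close>

lemma homogenization_quasimorphism:
  fixes F :: "'a \<Rightarrow> real"
  assumes K: "subgroup K G"
    and F: "\<And>x y. x \<in> K \<Longrightarrow> y \<in> K \<Longrightarrow> \<bar>F (x \<otimes> y) - F x - F y\<bar> \<le> D"
  shows "\<exists>\<Phi>. hom_qm G K \<Phi> \<and> (\<forall>x\<in>K. \<bar>F x - \<Phi> x\<bar> \<le> D)"
proof -
  have "\<bar>F (x [^] (i + j)) - F (x [^] i) - F (x [^] j)\<bar> \<le> D" if "x \<in> K" for x and i j :: int
    using F[of "x [^] i" "x [^] j"] that subgroup_int_pow_closed[OF K that]
      int_pow_mult[of x i j] subgroup.mem_carrier[OF K that] by simp
  from homogenization_exists[OF K this]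
  obtain \<Phi> where \<Phi>: "\<forall>x. x \<notin> K \<longrightarrow> \<Phi> x = 0" "\<forall>x\<in>K. \<bar>F x - \<Phi> x\<bar> \<le> D"
    "\<forall>x\<in>K. \<forall>n::int. \<Phi> (x [^] n) = of_int n * \<Phi> x"
    by blast
  have "\<bar>\<Phi> (x \<otimes> y) - \<Phi> x - \<Phi> y\<bar> \<le> 4 * D" if "x \<in> K" "y \<in> K" for x y
    using F[OF that] bspec[OF \<Phi>(2) that(1)] bspec[OF \<Phi>(2) that(2)]
      bspec[OF \<Phi>(2) subgroup.m_closed[OF K that]] by (simp add: abs_le_iff)
  then show ?thesis using \<Phi> unfolding hom_qm_def by blast
qed

lemma hom_qm_inv:
  assumes "subgroup H G" "hom_qm G H f" "x \<in> H"
  shows "f (inv x) = - f x"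
proof -
  have "f (x [^] (- 1 :: int)) = of_int (- 1) * f x"
    using assms(2,3) unfolding hom_qm_def by blast
  then show ?thesis
    using subgroup.mem_carrier[OF assms(1,3)] by (simp add: int_pow_neg)
qed

end

section \<open>Bounded primitives of bilinear forms\<close>

context abelian_quotient
begin

text \<open>On \<open>N\<close> the form vanishes, so \<phi> is a quasimorphism there and
  \<open>f\<close> is its homogenization. Invariance holds first up to a bounded error and then
  exactly, by homogeneity.\<close>

lemma quasimorphism_of_primitive:
  assumes w: "bilin w" and prim: "bounded_primitive w \<phi>"
  obtains f C where "f \<in> QNG G N" "\<And>x. x \<in> N \<Longrightarrow> \<bar>\<phi> x - f x\<bar> \<le> C"
proof -
  obtain D where D: "\<And>x y. x \<in> carrier G \<Longrightarrow> y \<in> carrier G \<Longrightarrow> \<bar>\<phi> (x \<otimes> y) - \<phi> x - \<phi> y + w (x, y)\<bar> \<le> D"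
    using prim unfolding bounded_primitive_def by blast
  have "\<bar>\<phi> (x \<otimes> y) - \<phi> x - \<phi> y\<bar> \<le> D" if "x \<in> N" "y \<in> N" for x y
    using D[of x y] that bilin_simps(9)[OF w that(2), of x] by simp
  then obtain f where f: "hom_qm G N f" "\<And>x. x \<in> N \<Longrightarrow> \<bar>\<phi> x - f x\<bar> \<le> D"
    using homogenization_quasimorphism[OF N_subgroup, of \<phi> D] by blast
  have homog: "f (x [^] (n::int)) = of_int n * f x" if "x \<in> N" for x n
    using f(1) that unfolding hom_qm_def by blast
  have "f (g \<otimes> x \<otimes> inv g) = f x" if g: "g \<in> carrier G" and x: "x \<in> N" for g x
  proof (rule homogeneous_cong[of "\<lambda>z. f (g \<otimes> z \<otimes> inv g)"])
    fix n :: int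
    have gx: "g \<otimes> x \<otimes> inv g \<in> N" using inv_op_closed2 g x by blast
    show "f (x [^] n) = of_int n * f x" using homog x .
    show "f (g \<otimes> x [^] n \<otimes> inv g) = of_int n * f (g \<otimes> x \<otimes> inv g)"
      using homog[OF gx, of n] int_pow_conj[OF g, of x n] x by simp
    \<comment> \<open>Expand \<phi> on both sides of
      \<open>(g \<otimes> z \<otimes> inv g) \<otimes> g = g \<otimes> z\<close>; both values of
      \<open>w\<close> are 0 because one entry lies in \<open>N\<close>.\<close>
    have close: "\<bar>f (g \<otimes> z \<otimes> inv g) - f z\<bar> \<le> 4 * D" if z: "z \<in> N" for z
    proof -
      have zc: "z \<in> carrier G" using z by simp
      have gz: "g \<otimes> z \<otimes> inv g \<in> N" using inv_op_closed2 g z by blast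
      have eq: "g \<otimes> z \<otimes> inv g \<otimes> g = g \<otimes> z" using g zc by (simp add: m_assoc)
      have "w (g, z) = 0" "w (g \<otimes> z \<otimes> inv g, g) = 0"
        using bilin_simps(9)[OF w z] bilin_simps(10)[OF w gz] by blast+
      then show ?thesis
        using D[OF g zc] D[of "g \<otimes> z \<otimes> inv g" g] g zc f(2)[OF z] f(2)[OF gz] eq
        by (simp add: abs_le_iff)
    qed
    show "\<bar>f (g \<otimes> x [^] n \<otimes> inv g) - f (x [^] n)\<bar> \<le> 4 * D"
      by (intro close subgroup_int_pow_closed N_subgroup x)
  qed
  then show ?thesis using f that unfolding QNG_def conj_inv_def by blast
qed

text \<open>If \<open>w\<close> is the coboundary of \<theta>, then \<open>\<phi> - \<theta>\<close>
  is a quasimorphism of \<open>G\<close>, while \<theta> is an invariant homomorphism on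
  \<open>N\<close>. With \<psi> the homogenization of the former, \<open>f\<close> and
  \<open>\<theta> + \<psi>\<close> are homogeneous and boundedly close on \<open>N\<close>, hence
  equal there.\<close>

lemma extendable_of_coboundary:
  assumes w: "bilin w" and prim: "bounded_primitive w \<phi>" and f: "f \<in> QNG G N"
    and C: "\<And>x. x \<in> N \<Longrightarrow> \<bar>\<phi> x - f x\<bar> \<le> C" and B2: "w \<in> B2 G"
  shows "f \<in> fspan (H1NG G N \<union> QG_restr G N)"
proof -
  obtain D where D: "\<And>x y. x \<in> carrier G \<Longrightarrow> y \<in> carrier G \<Longrightarrow> \<bar>\<phi> (x \<otimes> y) - \<phi> x - \<phi> y + w (x, y)\<bar> \<le> D"
    using prim unfolding bounded_primitive_def by blast
  obtain \<theta> where \<theta>: "w = cobound1 G \<theta>" using B2 unfolding B2_def by blast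
  have \<theta>_mult: "\<theta> (x \<otimes> y) = \<theta> x + \<theta> y - w (x, y)" if "x \<in> carrier G" "y \<in> carrier G" for x y
    unfolding \<theta> cobound1_def using that by simp
  have "\<bar>(\<phi> (x \<otimes> y) - \<theta> (x \<otimes> y)) - (\<phi> x - \<theta> x) - (\<phi> y - \<theta> y)\<bar> \<le> D"
    if "x \<in> carrier G" "y \<in> carrier G" for x y
    using D[OF that] \<theta>_mult[OF that] by (simp add: abs_le_iff)
  then obtain \<psi> where \<psi>: "hom_qm G (carrier G) \<psi>" "\<And>x. x \<in> carrier G \<Longrightarrow> \<bar>(\<phi> x - \<theta> x) - \<psi> x\<bar> \<le> D"
    using homogenization_quasimorphism[OF subgroup_self, of "\<lambda>x. \<phi> x - \<theta> x" D] by blast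
  let ?h = "\<lambda>x. if x \<in> N then \<theta> x else 0"
  let ?v = "\<lambda>x. if x \<in> N then \<psi> x else 0"
  have h: "real_hom G N ?h"
    unfolding real_hom_def using \<theta>_mult bilin_simps(9)[OF w] by auto
  have "\<theta> (g \<otimes> x \<otimes> inv g) = \<theta> x" if g: "g \<in> carrier G" and x: "x \<in> N" for g x
  proof -
    have xc: "x \<in> carrier G" using x by simp
    have gx: "g \<otimes> x \<otimes> inv g \<in> N" using inv_op_closed2 g x by blast
    have "g \<otimes> x \<otimes> inv g \<otimes> g = g \<otimes> x" using g xc by (simp add: m_assoc)
    moreover have "w (g, x) = 0" "w (g \<otimes> x \<otimes> inv g, g) = 0"
      using bilin_simps(9)[OF w x] bilin_simps(10)[OF w gx] by blast+
    ultimately show ?thesis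
      using \<theta>_mult[OF g xc] \<theta>_mult[of "g \<otimes> x \<otimes> inv g" g] g xc by simp
  qed
  then have "?h \<in> H1NG G N"
    unfolding H1NG_def conj_inv_def using h inv_op_closed2 by auto
  moreover have "?v \<in> QG_restr G N" unfolding QG_restr_def using \<psi>(1) by blast
  moreover have "f = (\<lambda>x. 1 * ?h x + 1 * ?v x)"
  proof
    fix x
    show "f x = 1 * ?h x + 1 * ?v x"
    proof (cases "x \<in> N")
      case False
      then show ?thesis using f by (simp add: QNG_def hom_qm_def)
    next
      case x: True
      show ?thesis
      proof (rule homogeneous_cong)
        fix n :: int
        have xn: "x [^] n \<in> N" using subgroup_int_pow_closed[OF N_subgroup x] .
        show "f (x [^] n) = of_int n * f x" using f x unfolding QNG_def hom_qm_def by blast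
        show "1 * ?h (x [^] n) + 1 * ?v (x [^] n) = of_int n * (1 * ?h x + 1 * ?v x)"
          using real_hom_int_pow[OF N_subgroup h x, of n] \<psi>(1) x xn
          unfolding hom_qm_def by (simp add: algebra_simps)
        show "\<bar>f (x [^] n) - (1 * ?h (x [^] n) + 1 * ?v (x [^] n))\<bar> \<le> C + D"
          using C[OF xn] \<psi>(2)[of "x [^] n"] xn by (simp add: abs_le_iff)
      qed
    qed
  qed
  ultimately show ?thesis
    using flinD[OF flin_fspan, of ?h "H1NG G N \<union> QG_restr G N" ?v 1 1]
      fspan_superset[of "H1NG G N \<union> QG_restr G N"] by auto
qed

text \<open>The symmetric part of \<open>w\<close> is the coboundary of \<open>- q\<close> with \<open>q x = w (x, x) / 2\<close>. The
  antisymmetric part vanishes on pairs of powers of one element, so a bounded primitive of it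
  can be homogenized.\<close>
lemma coboundary_of_extendable:
  assumes w: "bilin w" and prim: "bounded_primitive w \<phi>"
    and C: "\<And>x. x \<in> N \<Longrightarrow> \<bar>\<phi> x - f x\<bar> \<le> C"
    and f: "f \<in> fspan (H1NG G N \<union> QG_restr G N)"
  shows "w \<in> B2 G"
proof -
  obtain D where D: "\<And>x y. x \<in> carrier G \<Longrightarrow> y \<in> carrier G \<Longrightarrow> \<bar>\<phi> (x \<otimes> y) - \<phi> x - \<phi> y + w (x, y)\<bar> \<le> D"
    using prim unfolding bounded_primitive_def by blast
  obtain h v where hv: "h \<in> H1NG G N" "v \<in> QG_restr G N" "f = (\<lambda>x. h x + v x)"
    using f unfolding fspan_Un fspan_eq[OF flin_H1NG] fspan_eq[OF flin_QG_restr] by blast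
  have h: "real_hom G N h" "conj_inv G N h" using hv(1) by (simp_all add: H1NG_def)
  obtain \<psi> where \<psi>: "hom_qm G (carrier G) \<psi>" "v = (\<lambda>x. if x \<in> N then \<psi> x else 0)"
    using hv(2) unfolding QG_restr_def by blast
  obtain D' where D': "\<And>x y. x \<in> carrier G \<Longrightarrow> y \<in> carrier G \<Longrightarrow> \<bar>\<psi> (x \<otimes> y) - \<psi> x - \<psi> y\<bar> \<le> D'"
    using \<psi>(1) unfolding hom_qm_def by blast
  define q where "q x = w (x, x) / 2" for x
  define w' where "w' = (\<lambda>(x, y). (1/2) * w (x, y) + (- 1/2) * w (y, x))"
  have w'_eq: "w' (x, y) = (1/2) * w (x, y) + (- 1/2) * w (y, x)" for x y by (simp add: w'_def)
  have w': "bilin w'"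
    unfolding bilin_def w'_eq by (intro allI conjI flinD[OF flin_chars] bilinD w)
  have q_mult: "q (x \<otimes> y) = q x + q y + (w (x, y) + w (y, x)) / 2"
    if "x \<in> carrier G" "y \<in> carrier G" for x y
    using that by (simp add: q_def bilin_simps[OF w] field_simps)
  \<comment> \<open>Subtracting \<psi> leaves a function close to \<open>h\<close> on
    \<open>N\<close>, where \<open>q\<close> vanishes; adding \<open>q\<close> removes the symmetric
    part, so \<open>F\<close> is a bounded primitive of \<open>w'\<close>.\<close>
  define F where "F x = \<phi> x - \<psi> x + q x" for x
  have F: "\<bar>F (x \<otimes> y) - F x - F y + w' (x, y)\<bar> \<le> D + D'" if "x \<in> carrier G" "y \<in> carrier G" for x y
    unfolding F_def w'_eq q_mult[OF that] using D[OF that] D'[OF that]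
    by (simp add: field_simps abs_le_iff)
  have cyclic: "\<bar>F (x [^] (i + j)) - F (x [^] i) - F (x [^] j)\<bar> \<le> D + D'" if "x \<in> carrier G" for x and i j :: int
  proof -
    have "w' (x [^] i, x [^] j) = 0" using that by (simp add: w'_eq bilin_simps[OF w])
    then show ?thesis
      using F[of "x [^] i" "x [^] j"] that int_pow_mult[OF that, of i j] by simp
  qed
  from homogenization_exists[OF subgroup_self cyclic]
  obtain \<Phi> where "\<forall>x\<in>carrier G. \<bar>F x - \<Phi> x\<bar> \<le> D + D'"
    "\<forall>x\<in>carrier G. \<forall>n::int. \<Phi> (x [^] n) = of_int n * \<Phi> x"
    by blast
  then have \<Phi>: "\<And>x. x \<in> carrier G \<Longrightarrow> \<bar>F x - \<Phi> x\<bar> \<le> D + D'"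
    "\<And>x n. x \<in> carrier G \<Longrightarrow> \<Phi> (x [^] (n::int)) = of_int n * \<Phi> x"
    by simp_all
  have "\<Phi> x = h x" if x: "x \<in> N" for x
  proof (rule homogeneous_cong)
    fix n :: int
    show "\<Phi> (x [^] n) = of_int n * \<Phi> x" using \<Phi>(2) x by simp
    show "h (x [^] n) = of_int n * h x" using real_hom_int_pow[OF N_subgroup h(1) x] .
    have xn: "x [^] n \<in> N" using subgroup_int_pow_closed[OF N_subgroup x] .
    then have "q (x [^] n) = 0" using bilin_simps(9)[OF w] by (simp add: q_def)
    then show "\<bar>\<Phi> (x [^] n) - h (x [^] n)\<bar> \<le> D + D' + C"
      using \<Phi>(1)[of "x [^] n"] C[OF xn] xn x unfolding hv(3) \<psi>(2) F_def by (simp add: abs_le_iff)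
  qed
  moreover have "bounded_primitive w' \<Phi>"
    unfolding bounded_primitive_def
  proof (intro exI ballI)
    fix x y assume xy: "x \<in> carrier G" "y \<in> carrier G"
    show "\<bar>\<Phi> (x \<otimes> y) - \<Phi> x - \<Phi> y + w' (x, y)\<bar> \<le> 4 * (D + D')"
      using F[OF xy] \<Phi>(1)[OF xy(1)] \<Phi>(1)[OF xy(2)] \<Phi>(1)[OF m_closed[OF xy]]
      by (simp add: abs_le_iff)
  qed
  ultimately have "\<Phi> (x \<otimes> y) = \<Phi> x + \<Phi> y - w' (x, y)" if "x \<in> carrier G" "y \<in> carrier G" for x y
    using homogeneous_primitive_exact[OF w' _ _ _ h] \<Phi>(2) that by (simp add: w'_eq)
  then have "w p = cobound1 G (\<lambda>x. \<Phi> x - q x) p" for p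
    by (cases p) (auto simp: cobound1_def q_mult w'_eq bilin_simps[OF w] field_simps)
  then show ?thesis unfolding B2_def by blast
qed

text \<open>For fixed \<open>y\<close>, the function \<open>f (commut x y)\<close> is a
  quasimorphism in \<open>x\<close>; its homogenization \<open>A y\<close> is a character.
  Antisymmetry of the commutator then transfers additivity to \<open>y\<close>.\<close>

lemma commutator_form_exists:
  assumes f: "f \<in> QNG G N"
  obtains w E where "bilin w" "\<And>x y. w (y, x) = - w (x, y)"
    "\<And>x y. x \<in> carrier G \<Longrightarrow> y \<in> carrier G \<Longrightarrow> \<bar>f (commut x y) + 2 * w (x, y)\<bar> \<le> E"
proof -
  have qm: "hom_qm G N f" using f by (simp add: QNG_def)
  obtain D where D: "\<And>x y. x \<in> N \<Longrightarrow> y \<in> N \<Longrightarrow> \<bar>f (x \<otimes> y) - f x - f y\<bar> \<le> D"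
    using qm unfolding hom_qm_def by blast
  have conj: "f (g \<otimes> x \<otimes> inv g) = f x" "g \<otimes> x \<otimes> inv g \<in> N" if "g \<in> carrier G" "x \<in> N" for g x
    using f that inv_op_closed2 by (auto simp: QNG_def conj_inv_def)
  have anti: "f (commut y x) = - f (commut x y)" if "x \<in> carrier G" "y \<in> carrier G" for x y
    using hom_qm_inv[OF N_subgroup qm commut_in[OF that]] inv_commut[OF that] by simp
  have left: "\<bar>f (commut (x \<otimes> x') y) - f (commut x y) - f (commut x' y)\<bar> \<le> D"
    if "x \<in> carrier G" "x' \<in> carrier G" "y \<in> carrier G" for x x' y
    using D[OF conj(2)[OF that(1) commut_in[OF that(2,3)]] commut_in[OF that(1,3)]]
      commut_mult_left[OF that] conj(1)[OF that(1) commut_in[OF that(2,3)]] by simp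
  \<comment> \<open>The commutator is \<open>x\<close> times a conjugate of \<open>inv x\<close>,
    and the values of \<open>f\<close> at these two factors cancel.\<close>
  have small: "\<bar>f (commut x y)\<bar> \<le> D" if "x \<in> N" "y \<in> carrier G" for x y
  proof -
    have "commut x y = x \<otimes> (y \<otimes> inv x \<otimes> inv y)"
      using that by (simp add: commut_def m_assoc)
    moreover have "inv x \<in> N" using that by simp
    ultimately show ?thesis
      using D[OF that(1) conj(2)[OF that(2), of "inv x"]] conj(1)[OF that(2), of "inv x"]
        hom_qm_inv[OF N_subgroup qm that(1)] by simp
  qed
  have "\<exists>\<Phi>. hom_qm G (carrier G) \<Phi> \<and> (\<forall>x\<in>carrier G. \<bar>f (commut x y) - \<Phi> x\<bar> \<le> D)"
    if "y \<in> carrier G" for y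
    using left[OF _ _ that] by (rule homogenization_quasimorphism[OF subgroup_self])
  then obtain A where A: "\<And>y. y \<in> carrier G \<Longrightarrow> hom_qm G (carrier G) (A y)"
    "\<And>x y. x \<in> carrier G \<Longrightarrow> y \<in> carrier G \<Longrightarrow> \<bar>f (commut x y) - A y x\<bar> \<le> D"
    by metis
  have bilin_0: "bilin (\<lambda>_. 0)" by (simp add: bilin_def chars_def real_hom_def)
  have A_chars: "A y \<in> chars" if y: "y \<in> carrier G" for y
  proof -
    have homog: "A y (x [^] (n::int)) = of_int n * A y x" if "x \<in> carrier G" for x n
      using A(1)[OF y] that unfolding hom_qm_def by blast
    have zero: "A y x = 0" if x: "x \<in> N" for x
    proof (rule homogeneous_cong[of "A y" x "\<lambda>_. 0" "2 * D"])
      fix n :: int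
      have xn: "x [^] n \<in> N" using subgroup_int_pow_closed[OF N_subgroup x] .
      then show "\<bar>A y (x [^] n) - 0\<bar> \<le> 2 * D"
        using A(2)[of "x [^] n" y] small[OF xn y] y x by (simp add: abs_le_iff)
    qed (use homog x in auto)
    \<comment> \<open>A homogeneous quasimorphism that vanishes on \<open>N\<close> is a homogeneous
      bounded primitive of the zero form, so the exactness lemma makes it a homomorphism.\<close>
    have "A y (x \<otimes> x') = A y x + A y x' - (\<lambda>_. 0) (x, x')" if "x \<in> carrier G" "x' \<in> carrier G" for x x'
    proof (rule homogeneous_primitive_exact[OF bilin_0, of _ "\<lambda>_. 0"])
      show "bounded_primitive (\<lambda>_. 0) (A y)"
        using A(1)[OF y] unfolding bounded_primitive_def hom_qm_def by simp
    qed (use that zero homog in \<open>auto simp: real_hom_def conj_inv_def\<close>)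
    then show ?thesis
      using A(1)[OF y] zero by (simp add: chars_def real_hom_def hom_qm_def)
  qed
  have A_scale: "a = b" if "\<And>n::nat. \<bar>real n * (a - b)\<bar> \<le> C" for a b C :: real
    using bounded_multiples_zero[of "a - b" C] that by simp
  \<comment> \<open>The factor \<open>- 1/2\<close> matches the value \<open>- 2 * w (x, y)\<close>
    that a primitive of an antisymmetric \<open>w\<close> takes on commutators, up to a bounded
    error.\<close>
  define w where "w = (\<lambda>(x, y). if y \<in> carrier G then - (A y x / 2) else 0)"
  have w: "bilin w"
    unfolding bilin_def
  proof (intro conjI allI)
    fix y show "(\<lambda>x. w (x, y)) \<in> chars"
      using flinD[OF flin_chars A_chars A_chars, of y y "- 1/2" 0] flin_chars
      by (cases "y \<in> carrier G") (simp_all add: w_def flin_def)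
  next
    fix x
    \<comment> \<open>Antisymmetry moves \<open>y\<close> into the first entry, where
      \<open>left\<close> applies; evaluating at \<open>x [^] n\<close> then removes the
      error.\<close>
    have "A (y \<otimes> y') x = A y x + A y' x" if y: "y \<in> carrier G" "y' \<in> carrier G" and x: "x \<in> carrier G" for y y'
    proof (rule A_scale[of _ _ "4 * D"])
      fix n :: nat
      have xn: "x [^] n \<in> carrier G" using x by simp
      have "\<bar>A (y \<otimes> y') (x [^] n) - A y (x [^] n) - A y' (x [^] n)\<bar> \<le> 4 * D"
        using A(2)[OF xn y(1)] A(2)[OF xn y(2)] A(2)[OF xn m_closed[OF y]] left[OF y xn]
          anti[OF xn y(1)] anti[OF xn y(2)] anti[OF xn m_closed[OF y]] by (simp add: abs_le_iff)
      then show "\<bar>real n * (A (y \<otimes> y') x - (A y x + A y' x))\<bar> \<le> 4 * D"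
        using chars_nat_pow[OF A_chars x] y by (simp add: algebra_simps)
    qed
    moreover have "A y x = 0" if y: "y \<in> N" and x: "x \<in> carrier G" for y
    proof (rule A_scale[of _ _ "2 * D"])
      fix n :: nat
      have xn: "x [^] n \<in> carrier G" and yc: "y \<in> carrier G" using x y by auto
      have "\<bar>A y (x [^] n)\<bar> \<le> 2 * D"
        using A(2)[OF xn yc] small[OF y xn] anti[OF xn yc] by (simp add: abs_le_iff)
      then show "\<bar>real n * (A y x - 0)\<bar> \<le> 2 * D"
        using chars_nat_pow[OF A_chars[OF yc] x] by simp
    qed
    ultimately show "(\<lambda>y. w (x, y)) \<in> chars"
      using chars_outside[OF A_chars]
      by (cases "x \<in> carrier G") (auto simp: w_def chars_def real_hom_def add_divide_distrib)
  qed
  have close: "\<bar>f (commut x y) + 2 * w (x, y)\<bar> \<le> D" if "x \<in> carrier G" "y \<in> carrier G" for x y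
    using A(2)[OF that] that by (simp add: w_def)
  have "w (y, x) = - w (x, y)" for x y
  proof (cases "x \<in> carrier G \<and> y \<in> carrier G")
    case True
    then have x: "x \<in> carrier G" and y: "y \<in> carrier G" by auto
    show ?thesis
    proof (rule A_scale[of _ _ D])
      fix n :: nat
      have xn: "x [^] n \<in> carrier G" using x by simp
      show "\<bar>real n * (w (y, x) - - w (x, y))\<bar> \<le> D"
        using close[OF xn y] close[OF y xn] anti[OF xn y] bilin_simps(7,8)[OF w x]
        by (simp add: algebra_simps abs_le_iff)
    qed
  next
    case False
    then show ?thesis using bilin_simps(11,12)[OF w] by auto
  qed
  with w close show ?thesis using that by blast
qed

end

section \<open>Extending an invariant quasimorphism\<close>

context group
begin

text \<open>\<open>K\<close> represents the integers modulo those \<open>i\<close> with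
  \<open>g [^] i \<in> H\<close>. Adding two representatives produces a carry
  \<open>k + l - j\<close>, and the last clause bounds \<phi> on all carries.\<close>

lemma transversal_of_powers:
  fixes \<phi> :: "'a \<Rightarrow> real"
  assumes H: "subgroup H G" and g: "g \<in> carrier G"
  shows "\<exists>K::int set. \<exists>C. 0 \<in> K \<and> (\<forall>k\<in>K. \<forall>l\<in>K. g [^] (k - l) \<in> H \<longrightarrow> k = l) \<and>
    (\<forall>i. \<exists>j\<in>K. g [^] (i - j) \<in> H) \<and>
    (\<forall>k\<in>K. \<forall>l\<in>K. \<forall>j\<in>K. g [^] (k + l - j) \<in> H \<longrightarrow> \<bar>\<phi> (g [^] (k + l - j))\<bar> \<le> C)"
proof -
  have abs_in: "g [^] \<bar>i\<bar> \<in> H" if "g [^] i \<in> H" for i :: int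
    using that subgroup.m_inv_closed[OF H that] int_pow_neg[OF g, of i] by (simp add: abs_if)
  show ?thesis
  proof (cases "\<exists>m::nat. 0 < m \<and> g [^] int m \<in> H")
    case False
    have zero: "i = 0" if "g [^] i \<in> H" for i :: int
    proof (rule ccontr)
      assume "i \<noteq> 0"
      then have "0 < nat \<bar>i\<bar> \<and> g [^] int (nat \<bar>i\<bar>) \<in> H" using abs_in[OF that] by simp
      then show False using False by blast
    qed
    have "g [^] (i - i) \<in> H" for i :: int using H by (simp add: subgroup.one_closed)
    \<comment> \<open>No nontrivial power lies in \<open>H\<close>: every integer represents itself
      and the only carry is 0.\<close>
    then show ?thesis
      using zero by (intro exI[of _ UNIV] exI[of _ "\<bar>\<phi> \<one>\<bar>"]) fastforce
  next
    case True
    define m where "m = (LEAST m::nat. 0 < m \<and> g [^] int m \<in> H)"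
    have m: "0 < m" "g [^] int m \<in> H" using LeastI_ex[OF True] by (simp_all add: m_def)
    have least: "m \<le> k" if "0 < k" "g [^] int k \<in> H" for k
      unfolding m_def using that by (intro Least_le) simp
    \<comment> \<open>With \<open>m\<close> the least positive exponent, the representatives are the
      residues modulo \<open>m\<close>, and the carries lie in a finite interval.\<close>
    show ?thesis
    proof (intro exI[of _ "{0..<int m}"] exI[of _ "Max ((\<lambda>i. \<bar>\<phi> (g [^] i)\<bar>) ` {- int m..2 * int m})"]
        conjI ballI allI impI)
      show "0 \<in> {0..<int m}" using m by simp
    next
      fix k l assume kl: "k \<in> {0..<int m}" "l \<in> {0..<int m}" "g [^] (k - l) \<in> H"
      show "k = l"
      proof (rule ccontr)
        assume "k \<noteq> l"
        then have "m \<le> nat \<bar>k - l\<bar>" using abs_in[OF kl(3)] by (intro least) simp_all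
        then show False using kl(1,2) by (simp add: abs_if split: if_splits)
      qed
    next
      fix i
      have "g [^] (int m * (i div int m)) \<in> H"
        using subgroup_int_pow_closed[OF H m(2), of "i div int m"] int_pow_pow[OF g] by simp
      moreover have "int m * (i div int m) = i - i mod int m"
        by (simp add: minus_mod_eq_mult_div)
      ultimately show "\<exists>j\<in>{0..<int m}. g [^] (i - j) \<in> H"
        using m by (intro bexI[of _ "i mod int m"]) auto
    next
      fix k l j assume "k \<in> {0..<int m}" "l \<in> {0..<int m}" "j \<in> {0..<int m}"
      then show "\<bar>\<phi> (g [^] (k + l - j))\<bar> \<le> Max ((\<lambda>i. \<bar>\<phi> (g [^] i)\<bar>) ` {- int m..2 * int m})"
        by (intro Max_ge) auto
    qed
  qed
qed

end

context abelian_quotient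
begin

text \<open>Extend by \<open>h g\<^sup>k \<mapsto> \<phi> h - k w (h, g)\<close>, with \<open>k\<close> ranging over representatives
  modulo the powers of \<open>g\<close> that lie in \<open>H\<close>.\<close>
lemma bounded_primitive_extend:
  assumes w: "bilin w" and anti: "\<And>x y. w (y, x) = - w (x, y)"
    and E: "\<And>x y. x \<in> carrier G \<Longrightarrow> y \<in> carrier G \<Longrightarrow> \<bar>f (commut x y) + 2 * w (x, y)\<bar> \<le> E"
    and H: "subgroup H G" and NH: "N \<subseteq> H" and \<phi>N: "\<And>x. x \<in> N \<Longrightarrow> \<phi> x = f x"
    and D: "\<And>x y. x \<in> H \<Longrightarrow> y \<in> H \<Longrightarrow> \<bar>\<phi> (x \<otimes> y) - \<phi> x - \<phi> y + w (x, y)\<bar> \<le> D"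
    and g: "g \<in> carrier G"
  shows "\<exists>H' \<phi>'. subgroup H' G \<and> insert g H \<subseteq> H' \<and> (\<forall>x\<in>N. \<phi>' x = f x) \<and>
    (\<exists>D. \<forall>x\<in>H'. \<forall>y\<in>H'. \<bar>\<phi>' (x \<otimes> y) - \<phi>' x - \<phi>' y + w (x, y)\<bar> \<le> D)"
proof -
  have Hc: "x \<in> carrier G" if "x \<in> H" for x using subgroup.mem_carrier[OF H that] .
  have Hm: "x \<otimes> y \<in> H" if "x \<in> H" "y \<in> H" for x y using subgroup.m_closed[OF H that] .
  obtain K :: "int set" and C where K0: "0 \<in> K" and "\<forall>k\<in>K. \<forall>l\<in>K. g [^] (k - l) \<in> H \<longrightarrow> k = l"
    and Kred: "\<forall>i. \<exists>j\<in>K. g [^] (i - j) \<in> H"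
    and "\<forall>k\<in>K. \<forall>l\<in>K. \<forall>j\<in>K. g [^] (k + l - j) \<in> H \<longrightarrow> \<bar>\<phi> (g [^] (k + l - j))\<bar> \<le> C"
    using transversal_of_powers[OF H g, of \<phi>] by blast
  then have Kinj: "\<And>k l. k \<in> K \<Longrightarrow> l \<in> K \<Longrightarrow> g [^] (k - l) \<in> H \<Longrightarrow> k = l"
    and KC: "\<And>k l j. k \<in> K \<Longrightarrow> l \<in> K \<Longrightarrow> j \<in> K \<Longrightarrow> g [^] (k + l - j) \<in> H \<Longrightarrow> \<bar>\<phi> (g [^] (k + l - j))\<bar> \<le> C"
    by blast+
  define H' where "H' = {x \<in> carrier G. \<exists>k::int. x \<otimes> g [^] (- k) \<in> H}"
  have H': "\<exists>k\<in>K. x \<otimes> g [^] (- k) \<in> H" if x: "x \<in> H'" for x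
  proof -
    obtain i :: int where i: "x \<otimes> g [^] (- i) \<in> H" and xc: "x \<in> carrier G"
      using x unfolding H'_def by blast
    obtain j where j: "j \<in> K" "g [^] (i - j) \<in> H" using Kred by blast
    have "(x \<otimes> g [^] (- i)) \<otimes> g [^] (i - j) = x \<otimes> g [^] (- i + (i - j))"
      using xc g by (simp only: int_pow_mult m_assoc int_pow_closed)
    then have "x \<otimes> g [^] (- j) \<in> H" using Hm[OF i j(2)] by simp
    then show ?thesis using j by blast
  qed
  \<comment> \<open>With \<open>x = u g^k\<close> and \<open>y = v g^l\<close>, the part of
    \<open>x \<otimes> y\<close> in \<open>H\<close> is \<open>u c v r\<close>: the commutator
    \<open>c\<close> comes from moving \<open>g^k\<close> past \<open>y\<close>, and
    \<open>r\<close> is the carry.\<close>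
  have split: "(x \<otimes> y) \<otimes> g [^] (- j)
      = ((x \<otimes> g [^] (- k)) \<otimes> (commut (g [^] k) y \<otimes> (y \<otimes> g [^] (- l)))) \<otimes> g [^] (k + l - j)"
    if x: "x \<in> carrier G" and y: "y \<in> carrier G" for x y and j k l :: int
  proof -
    have "g [^] (- k) \<otimes> (commut (g [^] k) y \<otimes> z) = y \<otimes> (g [^] (- k) \<otimes> (inv y \<otimes> z))"
      if "z \<in> carrier G" for z
      using g y that by (simp add: commut_def m_assoc int_pow_neg)
    then have "((x \<otimes> g [^] (- k)) \<otimes> (commut (g [^] k) y \<otimes> (y \<otimes> g [^] (- l)))) \<otimes> g [^] (k + l - j)
        = x \<otimes> (y \<otimes> (g [^] (- k) \<otimes> (g [^] (- l) \<otimes> g [^] (k + l - j))))"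
      using g x y commut_in[of "g [^] k" y] by (simp add: m_assoc)
    also have "g [^] (- k) \<otimes> (g [^] (- l) \<otimes> g [^] (k + l - j)) = g [^] (- k + (- l + (k + l - j)))"
      using g by (simp only: int_pow_mult int_pow_closed)
    also have "- k + (- l + (k + l - j)) = - j" by simp
    finally show ?thesis using g x y by (simp add: m_assoc)
  qed
  have cH: "commut x y \<in> H" if "x \<in> carrier G" "y \<in> carrier G" for x y
    using commut_in[OF that] NH by blast
  have "subgroup H' G"
  proof (rule subgroupI)
    show "H' \<subseteq> carrier G" unfolding H'_def by blast
    have "\<one> \<in> H'" unfolding H'_def using subgroup.one_closed[OF H] by (intro CollectI conjI exI[of _ 0]) auto
    then show "H' \<noteq> {}" by blast
  next
    fix x assume "x \<in> H'"
    then obtain k :: int where x: "x \<in> carrier G" and k: "x \<otimes> g [^] (- k) \<in> H" unfolding H'_def by blast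
    have "inv x \<otimes> g [^] k = commut (inv x) (g [^] k) \<otimes> inv (x \<otimes> g [^] (- k))"
      using commut_mult[of "inv x" "g [^] k"] x g by (simp add: inv_mult_group int_pow_neg)
    also have "\<dots> \<in> H" using x g by (intro Hm[OF cH subgroup.m_inv_closed[OF H k]]) auto
    finally show "inv x \<in> H'" unfolding H'_def using x by (auto intro: exI[of _ "- k"])
  next
    fix x y assume "x \<in> H'" "y \<in> H'"
    then obtain k l :: int where x: "x \<in> carrier G" "x \<otimes> g [^] (- k) \<in> H"
      and y: "y \<in> carrier G" "y \<otimes> g [^] (- l) \<in> H" unfolding H'_def by blast
    have "(x \<otimes> y) \<otimes> g [^] (- (k + l))
      = ((x \<otimes> g [^] (- k)) \<otimes> (commut (g [^] k) y \<otimes> (y \<otimes> g [^] (- l)))) \<otimes> g [^] (k + l - (k + l))"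
      by (rule split) (use x y in auto)
    also have "\<dots> \<in> H" using g subgroup.one_closed[OF H]
      by (intro Hm[OF Hm[OF x(2) Hm[OF cH[OF _ y(1)] y(2)]]]) simp_all
    finally show "x \<otimes> y \<in> H'" unfolding H'_def using x y by blast
  qed
  moreover have "insert g H \<subseteq> H'"
  proof -
    have "g \<otimes> g [^] (- 1 :: int) = \<one>" using g by (simp add: int_pow_neg)
    then have "g \<in> H'" unfolding H'_def using g subgroup.one_closed[OF H] by (intro CollectI conjI exI[of _ 1]) auto
    moreover have "x \<in> H'" if "x \<in> H" for x
      unfolding H'_def using that Hc by (intro CollectI conjI exI[of _ 0]) auto
    ultimately show ?thesis by blast
  qed
  moreover define \<kappa> where "\<kappa> x = (SOME k. k \<in> K \<and> x \<otimes> g [^] (- k) \<in> H)" for x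
  have \<kappa>: "\<kappa> x \<in> K" "x \<otimes> g [^] (- \<kappa> x) \<in> H" if "x \<in> H'" for x
    using someI_ex[of "\<lambda>k. k \<in> K \<and> x \<otimes> g [^] (- k) \<in> H"] H'[OF that] unfolding \<kappa>_def by blast+
  define \<phi>' where "\<phi>' x = \<phi> (x \<otimes> g [^] (- \<kappa> x)) - of_int (\<kappa> x) * w (x, g)" for x
  have "\<phi>' x = f x" if x: "x \<in> N" for x
  proof -
    have "x \<in> H'" using \<open>insert g H \<subseteq> H'\<close> NH x by blast
    note k = \<kappa>[OF this]
    have xH: "x \<in> H" "x \<in> carrier G" using x NH by auto
    have "inv x \<otimes> (x \<otimes> g [^] (- \<kappa> x)) \<in> H"
      using Hm[OF subgroup.m_inv_closed[OF H xH(1)] k(2)] .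
    then have "g [^] (0 - \<kappa> x) \<in> H" using xH g by simp
    \<comment> \<open>As 0 is the representative of the exponents with power in \<open>H\<close>,
      the new function agrees with \<open>f\<close> on \<open>N\<close>.\<close>
    then have "\<kappa> x = 0" using Kinj[OF K0 k(1)] by simp
    then show ?thesis using xH \<phi>N[OF x] by (simp add: \<phi>'_def)
  qed
  moreover have "\<bar>\<phi>' (x \<otimes> y) - \<phi>' x - \<phi>' y + w (x, y)\<bar> \<le> 3 * D + E + C"
    if xH': "x \<in> H'" and yH': "y \<in> H'" for x y
  proof -
    define k l j where "k = \<kappa> x" and "l = \<kappa> y" and "j = \<kappa> (x \<otimes> y)"
    have x: "x \<in> carrier G" and y: "y \<in> carrier G" using xH' yH' unfolding H'_def by auto
    have xyH': "x \<otimes> y \<in> H'" using subgroup.m_closed[OF \<open>subgroup H' G\<close> xH' yH'] .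
    define u v c r where "u = x \<otimes> g [^] (- k)" and "v = y \<otimes> g [^] (- l)"
      and "c = commut (g [^] k) y" and "r = g [^] (k + l - j)"
    have u: "u \<in> H" and v: "v \<in> H" and z: "x \<otimes> y \<otimes> g [^] (- j) \<in> H"
      using \<kappa>(2)[OF xH'] \<kappa>(2)[OF yH'] \<kappa>(2)[OF xyH'] by (simp_all add: u_def v_def k_def l_def j_def)
    have cN: "c \<in> N" and c: "c \<in> H" using commut_in[of "g [^] k" y] cH[of "g [^] k" y] g y by (simp_all add: c_def)
    have z_eq: "x \<otimes> y \<otimes> g [^] (- j) = (u \<otimes> (c \<otimes> v)) \<otimes> r"
      unfolding u_def v_def c_def r_def by (rule split[OF x y])
    have cv: "c \<otimes> v \<in> H" and ucv: "u \<otimes> (c \<otimes> v) \<in> H" using u c v Hm by blast+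
    have rc: "r \<in> carrier G" using g by (simp add: r_def)
    have "r = inv (u \<otimes> (c \<otimes> v)) \<otimes> (x \<otimes> y \<otimes> g [^] (- j))"
      unfolding z_eq using Hc[OF ucv] rc by simp
    then have r: "r \<in> H" using Hm[OF subgroup.m_inv_closed[OF H ucv] z] by simp
    have \<phi>r: "\<bar>\<phi> r\<bar> \<le> C"
      using KC[OF \<kappa>(1)[OF xH'] \<kappa>(1)[OF yH'] \<kappa>(1)[OF xyH']] r by (simp add: r_def k_def l_def j_def)
    have wgg: "w (g, g) = 0" using anti[of g g] by simp
    have wc: "w (c, a) = 0" "w (a, c) = 0" for a using bilin_simps(9,10)[OF w cN] by blast+
    have wug: "w (u, g) = w (x, g)" and wvg: "w (v, g) = w (y, g)"
      using x y g wgg by (simp_all add: u_def v_def bilin_simps[OF w])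
    have wr: "w (a, r) = of_int (k + l - j) * w (a, g)" for a
      unfolding r_def using g by (simp add: bilin_simps(5)[OF w])
    have w1: "w (u \<otimes> (c \<otimes> v), r) = of_int (k + l - j) * (w (x, g) + w (y, g))"
      unfolding wr using Hc[OF u] Hc[OF v] Hc[OF c] by (simp add: bilin_simps[OF w] wc wug wvg)
    have w2: "w (u, c \<otimes> v) = w (x, y) - of_int l * w (x, g) + of_int k * w (y, g)"
      using Hc[OF v] Hc[OF c] x y g wgg anti[of y g]
      by (simp add: bilin_simps[OF w] wc) (simp add: u_def v_def bilin_simps[OF w] algebra_simps)
    have w3: "\<bar>f c - 2 * of_int k * w (y, g)\<bar> \<le> E"
      using E[of "g [^] k" y] g y anti[of y g] by (simp add: c_def bilin_simps[OF w])
    have w4: "w (x \<otimes> y, g) = w (x, g) + w (y, g)" using x y by (simp add: bilin_simps[OF w])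
    have e1: "\<phi>' (x \<otimes> y) = \<phi> ((u \<otimes> (c \<otimes> v)) \<otimes> r) - of_int j * (w (x, g) + w (y, g))"
      by (simp add: \<phi>'_def flip: j_def z_eq w4)
    have e2: "\<phi>' x = \<phi> u - of_int k * w (x, g)" "\<phi>' y = \<phi> v - of_int l * w (y, g)"
      by (simp_all add: \<phi>'_def u_def v_def k_def l_def)
    \<comment> \<open>Split \<phi> over the factors \<open>u\<close>, \<open>c\<close>,
      \<open>v\<close>, \<open>r\<close>. This leaves three defects on \<open>H\<close>, the bounded
      carry, and the commutator term bounded by \<open>E\<close>; \<open>w1\<close> and
      \<open>w2\<close> make the remaining bilinear terms cancel.\<close>
    have "\<phi>' (x \<otimes> y) - \<phi>' x - \<phi>' y + w (x, y)
      = (\<phi> ((u \<otimes> (c \<otimes> v)) \<otimes> r) - \<phi> (u \<otimes> (c \<otimes> v)) - \<phi> r + w (u \<otimes> (c \<otimes> v), r)) + \<phi> r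
        + (\<phi> (u \<otimes> (c \<otimes> v)) - \<phi> u - \<phi> (c \<otimes> v) + w (u, c \<otimes> v))
        + (\<phi> (c \<otimes> v) - \<phi> c - \<phi> v + w (c, v)) + (f c - 2 * of_int k * w (y, g))"
      unfolding e1 e2 w1 w2 wc \<phi>N[OF cN] by (simp add: algebra_simps)
    then show ?thesis
      using D[OF ucv r] D[OF u cv] D[OF c v] \<phi>r w3 by linarith
  qed
  ultimately show ?thesis by blast
qed

text \<open>The induction starts with \<open>f\<close> itself on \<open>N\<close>, where
  \<open>w\<close> vanishes, and adjoins one element of \<open>T\<close> at a time.\<close>

lemma bounded_primitive_extend_finite:
  assumes f: "f \<in> QNG G N" and w: "bilin w" and anti: "\<And>x y. w (y, x) = - w (x, y)"
    and E: "\<And>x y. x \<in> carrier G \<Longrightarrow> y \<in> carrier G \<Longrightarrow> \<bar>f (commut x y) + 2 * w (x, y)\<bar> \<le> E"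
    and T: "finite T" "T \<subseteq> carrier G"
  shows "\<exists>H \<phi>. subgroup H G \<and> N \<subseteq> H \<and> T \<subseteq> H \<and> (\<forall>x\<in>N. \<phi> x = f x) \<and>
    (\<exists>D. \<forall>x\<in>H. \<forall>y\<in>H. \<bar>\<phi> (x \<otimes> y) - \<phi> x - \<phi> y + w (x, y)\<bar> \<le> D)"
  using T
proof (induction T rule: finite_induct)
  case empty
  obtain D where D: "\<forall>x\<in>N. \<forall>y\<in>N. \<bar>f (x \<otimes> y) - f x - f y\<bar> \<le> D"
    using f unfolding QNG_def hom_qm_def by blast
  then have "\<forall>x\<in>N. \<forall>y\<in>N. \<bar>f (x \<otimes> y) - f x - f y + w (x, y)\<bar> \<le> D"
    using bilin_simps(9)[OF w] by simp
  then show ?case using N_subgroup by blast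
next
  case (insert g T)
  then obtain H \<phi> D where H: "subgroup H G" "N \<subseteq> H" "T \<subseteq> H" "\<forall>x\<in>N. \<phi> x = f x"
    "\<forall>x\<in>H. \<forall>y\<in>H. \<bar>\<phi> (x \<otimes> y) - \<phi> x - \<phi> y + w (x, y)\<bar> \<le> D"
    by blast
  obtain H' \<phi>' where "subgroup H' G" "insert g H \<subseteq> H'" "\<forall>x\<in>N. \<phi>' x = f x"
    "\<exists>D. \<forall>x\<in>H'. \<forall>y\<in>H'. \<bar>\<phi>' (x \<otimes> y) - \<phi>' x - \<phi>' y + w (x, y)\<bar> \<le> D"
    using bounded_primitive_extend[OF w anti E H(1,2), of \<phi> D g] H(4,5) insert.prems by auto
  then show ?case using H(2,3) by (intro exI[of _ H'] exI[of _ \<phi>']) auto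
qed

end

section \<open>The dimension formula\<close>

text \<open>\<open>T\<close> lifts a finite generating set of \<open>G / N\<close>. Generation is
  phrased through subgroups because it is applied to the subgroups reached by extension and to
  kernels of characters.\<close>

locale fg_abelian_quotient = abelian_quotient +
  fixes T :: "'a set"
  assumes finite_T: "finite T" and T_carrier: "T \<subseteq> carrier G"
    and generates: "subgroup H G \<Longrightarrow> N \<subseteq> H \<Longrightarrow> T \<subseteq> H \<Longrightarrow> H = carrier G"
begin

text \<open>The converse passage to \<open>quasimorphism_of_primitive\<close>: once all of
  \<open>T\<close> is adjoined, the extension is defined on \<open>G\<close>.\<close>

lemma primitive_of_quasimorphism:
  assumes f: "f \<in> QNG G N"
  obtains w \<phi> where "bilin w" "bounded_primitive w \<phi>" "\<And>x. x \<in> N \<Longrightarrow> \<phi> x = f x"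
proof -
  obtain w E where w: "bilin w" and anti: "\<And>x y. w (y, x) = - w (x, y)"
    and E: "\<And>x y. x \<in> carrier G \<Longrightarrow> y \<in> carrier G \<Longrightarrow> \<bar>f (commut x y) + 2 * w (x, y)\<bar> \<le> E"
    using commutator_form_exists[OF f] by metis
  obtain H \<phi> where H: "subgroup H G" "N \<subseteq> H" "T \<subseteq> H" "\<forall>x\<in>N. \<phi> x = f x"
    "\<exists>D. \<forall>x\<in>H. \<forall>y\<in>H. \<bar>\<phi> (x \<otimes> y) - \<phi> x - \<phi> y + w (x, y)\<bar> \<le> D"
    using bounded_primitive_extend_finite[OF f w anti E finite_T T_carrier] by blast
  have "H = carrier G" using generates H by blast
  then have "bounded_primitive w \<phi>" using H(5) unfolding bounded_primitive_def by simp
  then show ?thesis using that w H(4) by blast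
qed

text \<open>The kernel of a character contains \<open>N\<close>; if it also contains
  \<open>T\<close>, it is all of \<open>G\<close>. Characters are therefore determined by their
  values on \<open>T\<close>.\<close>

lemma dual_characters:
  obtains e where "\<And>t. t \<in> T \<Longrightarrow> e t \<in> chars" "\<And>a x. a \<in> chars \<Longrightarrow> a x = (\<Sum>t\<in>T. a t * e t x)"
proof -
  have "a = (\<lambda>_. 0)" if a: "a \<in> chars" and zero: "\<forall>t\<in>T. a t = 0" for a
  proof
    fix x
    let ?H = "{x \<in> carrier G. a x = 0}"
    have "a \<one> = 0" using chars_N[OF a subgroup.one_closed[OF N_subgroup]] .
    then have "subgroup ?H G"
      by (intro subgroupI) (auto simp: chars_mult[OF a] chars_inv[OF a])
    moreover have "N \<subseteq> ?H" "T \<subseteq> ?H" using chars_N[OF a] zero T_carrier by auto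
    ultimately have "?H = carrier G" by (rule generates)
    then show "a x = 0" using chars_outside[OF a, of x] by blast
  qed
  from dual_family_exists[OF finite_T flin_chars this]
  obtain e where e: "\<forall>t\<in>T. e t \<in> chars" "\<forall>a\<in>chars. a = (\<lambda>x. \<Sum>t\<in>T. a t * e t x)"
    by blast
  then have "a x = (\<Sum>t\<in>T. a t * e t x)" if "a \<in> chars" for a x
    using fun_cong[OF bspec[OF e(2) that], of x] by simp
  then show ?thesis using that[of e] e(1) by blast
qed

abbreviation cups :: "('a \<times> 'a \<Rightarrow> real) set" where
  "cups \<equiv> {cup11 a b | a b. a \<in> chars \<and> b \<in> chars}"

text \<open>Expanding both entries in the dual characters gives \<open>w (x, y)\<close> as the sum
  of \<open>w (s, t) * e s x * e t y\<close>. Finiteness of \<open>T\<close> thus makes both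
  dimensions in the theorem finite.\<close>

lemma bilin_span:
  "\<exists>B. finite B \<and> B \<subseteq> cups \<and> Collect bilin \<subseteq> fspan B"
proof -
  obtain e where e: "\<And>t. t \<in> T \<Longrightarrow> e t \<in> chars" "\<And>a x. a \<in> chars \<Longrightarrow> a x = (\<Sum>t\<in>T. a t * e t x)"
    using dual_characters by metis
  let ?e = "\<lambda>(s, t). cup11 (e s) (e t)"
  let ?B = "?e ` (T \<times> T)"
  have "w \<in> fspan ?B" if w: "bilin w" for w
  proof -
    have eq: "w (x, y) = (\<Sum>p\<in>T \<times> T. w p * ?e p (x, y))" for x y
    proof -
      have "w (x, y) = (\<Sum>s\<in>T. w (s, y) * e s x)" using e(2)[OF bilinD(2)[OF w]] .
      also have "\<dots> = (\<Sum>s\<in>T. (\<Sum>t\<in>T. w (s, t) * e t y) * e s x)"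
        by (simp only: e(2)[OF bilinD(1)[OF w], symmetric])
      also have "\<dots> = (\<Sum>p\<in>T \<times> T. w p * ?e p (x, y))"
        by (simp add: sum_distrib_left sum.cartesian_product cup11_def mult_ac case_prod_unfold)
      finally show ?thesis .
    qed
    have w_eq: "w = (\<lambda>q. \<Sum>p\<in>T \<times> T. w p * ?e p q)"
    proof
      fix q show "w q = (\<Sum>p\<in>T \<times> T. w p * ?e p q)" by (cases q) (simp only: eq)
    qed
    show ?thesis
      by (subst w_eq, intro flin_sum flin_fspan) (use finite_T fspan_superset[of ?B] in auto)
  qed
  moreover
  have "cup11 (e s) (e t) \<in> cups" if "s \<in> T" "t \<in> T" for s t
    using e(1)[OF that(1)] e(1)[OF that(2)] by blast
  then have "?B \<subseteq> cups" by (auto simp del: mem_Collect_eq)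
  ultimately show ?thesis using finite_T by (intro exI[of _ ?B]) auto
qed

lemma fspan_cups: "fspan cups = Collect bilin"
proof
  have "cups \<subseteq> Collect bilin"
    by (auto simp: bilin_def cup11_def chars_def real_hom_def algebra_simps)
  moreover have "flin (Collect bilin)"
    using flin_chars by (simp add: flin_def bilin_def)
  ultimately show "fspan cups \<subseteq> Collect bilin" by (intro fspan_least)
  obtain B where B: "finite B" "B \<subseteq> cups" "Collect bilin \<subseteq> fspan B"
    using bilin_span by (elim exE conjE)
  show "Collect bilin \<subseteq> fspan cups" using B(3) fspan_mono[OF B(2)] by (rule subset_trans)
qed

text \<open>The linear relation \<open>w ~ f\<close> to which \<open>quot_dim_transfer\<close> is
  applied.\<close>

definition controls :: "('a \<times> 'a \<Rightarrow> real) \<Rightarrow> ('a \<Rightarrow> real) \<Rightarrow> bool" where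
  "controls w f \<longleftrightarrow> bilin w \<and> f \<in> QNG G N \<and>
    (\<exists>\<phi> C. bounded_primitive w \<phi> \<and> (\<forall>x\<in>N. \<bar>\<phi> x - f x\<bar> \<le> C))"

lemma controls_linear:
  assumes "controls w f" "controls w' f'"
  shows "controls (\<lambda>p. a * w p + b * w' p) (\<lambda>x. a * f x + b * f' x)"
proof -
  obtain \<phi> C D where w: "bilin w" "f \<in> QNG G N" and C: "\<And>x. x \<in> N \<Longrightarrow> \<bar>\<phi> x - f x\<bar> \<le> C"
    and D: "\<And>x y. x \<in> carrier G \<Longrightarrow> y \<in> carrier G \<Longrightarrow> \<bar>\<phi> (x \<otimes> y) - \<phi> x - \<phi> y + w (x, y)\<bar> \<le> D"
    using assms(1) unfolding controls_def bounded_primitive_def by blast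
  obtain \<phi>' C' D' where w': "bilin w'" "f' \<in> QNG G N" and C': "\<And>x. x \<in> N \<Longrightarrow> \<bar>\<phi>' x - f' x\<bar> \<le> C'"
    and D': "\<And>x y. x \<in> carrier G \<Longrightarrow> y \<in> carrier G \<Longrightarrow> \<bar>\<phi>' (x \<otimes> y) - \<phi>' x - \<phi>' y + w' (x, y)\<bar> \<le> D'"
    using assms(2) unfolding controls_def bounded_primitive_def by blast
  let ?\<phi> = "\<lambda>x. a * \<phi> x + b * \<phi>' x"
  have "bilin (\<lambda>p. a * w p + b * w' p)"
    using w(1) w'(1) flinD[OF flin_chars] unfolding bilin_def by blast
  moreover have "(\<lambda>x. a * f x + b * f' x) \<in> QNG G N" by (rule flinD[OF flin_QNG w(2) w'(2)])
  moreover have "bounded_primitive (\<lambda>p. a * w p + b * w' p) ?\<phi>"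
    unfolding bounded_primitive_def
  proof (intro exI ballI)
    fix x y assume xy: "x \<in> carrier G" "y \<in> carrier G"
    have "?\<phi> (x \<otimes> y) - ?\<phi> x - ?\<phi> y + (a * w (x, y) + b * w' (x, y))
      = a * (\<phi> (x \<otimes> y) - \<phi> x - \<phi> y + w (x, y)) + b * (\<phi>' (x \<otimes> y) - \<phi>' x - \<phi>' y + w' (x, y))"
      by (simp add: algebra_simps)
    then show "\<bar>?\<phi> (x \<otimes> y) - ?\<phi> x - ?\<phi> y + (a * w (x, y) + b * w' (x, y))\<bar> \<le> \<bar>a\<bar> * D + \<bar>b\<bar> * D'"
      using abs_linear_bound[OF D[OF xy] D'[OF xy], of a b] by simp
  qed
  moreover have "\<bar>?\<phi> x - (a * f x + b * f' x)\<bar> \<le> \<bar>a\<bar> * C + \<bar>b\<bar> * C'" if "x \<in> N" for x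
  proof -
    have "?\<phi> x - (a * f x + b * f' x) = a * (\<phi> x - f x) + b * (\<phi>' x - f' x)"
      by (simp add: algebra_simps)
    then show ?thesis using abs_linear_bound[OF C[OF that] C'[OF that], of a b] by simp
  qed
  ultimately show ?thesis unfolding controls_def by blast
qed

text \<open>Surjectivity of the comparison map enters here: a bilinear form is a cocycle, and
  writing it as a bounded cocycle plus a coboundary yields a bounded primitive.\<close>

lemma controls_total:
  assumes "comparison2_surj G" "bilin w"
  shows "\<exists>f. controls w f"
proof -
  have "cocycle2 G w" unfolding cocycle2_def by (simp add: bilin_simps[OF assms(2)])
  then obtain \<beta> \<phi> C where "\<forall>g\<in>carrier G. \<forall>h\<in>carrier G. \<bar>\<beta> (g, h)\<bar> \<le> C"
    "\<forall>g\<in>carrier G. \<forall>h\<in>carrier G. w (g, h) = \<beta> (g, h) + cobound1 G \<phi> (g, h)"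
    using assms(1) unfolding comparison2_surj_def by blast
  then have "bounded_primitive w \<phi>"
    unfolding bounded_primitive_def by (intro exI[of _ C]) (simp add: cobound1_def)
  moreover from this obtain f C where "f \<in> QNG G N" "\<And>x. x \<in> N \<Longrightarrow> \<bar>\<phi> x - f x\<bar> \<le> C"
    using quasimorphism_of_primitive[OF assms(2)] by metis
  ultimately show ?thesis using assms(2) unfolding controls_def by blast
qed

lemma controls_onto:
  assumes "f \<in> QNG G N"
  shows "\<exists>w. controls w f"
proof -
  obtain w \<phi> where "bilin w" "bounded_primitive w \<phi>" "\<And>x. x \<in> N \<Longrightarrow> \<phi> x = f x"
    using primitive_of_quasimorphism[OF assms] by metis
  then have "controls w f"
    unfolding controls_def using assms by (auto intro!: exI[of _ \<phi>] exI[of _ 0])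
  then show ?thesis by blast
qed

lemma controls_iff:
  assumes "controls w f"
  shows "w \<in> B2 G \<longleftrightarrow> f \<in> fspan (H1NG G N \<union> QG_restr G N)"
  using assms extendable_of_coboundary coboundary_of_extendable unfolding controls_def by metis

lemma dim_eq:
  assumes "comparison2_surj G"
  shows "\<exists>n. quot_dim (QNG G N) (H1NG G N \<union> QG_restr G N) n \<and> quot_dim cups (B2 G) n"
proof -
  obtain B where B: "finite B" "B \<subseteq> cups" "Collect bilin \<subseteq> fspan B"
    using bilin_span by (elim exE conjE)
  have "cups \<subseteq> Collect bilin" using fspan_superset[of cups] unfolding fspan_cups .
  also note B(3)
  also have "fspan B \<subseteq> fspan (B \<union> B2 G)" by (intro fspan_mono) simp
  finally have "\<exists>n. quot_dim cups (B2 G) n"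
    by (rule quot_dim_exists[OF B(1) subset_trans[OF B(2) fspan_superset]])
  then obtain n where n: "quot_dim cups (B2 G) n" ..
  have "quot_dim (QNG G N) (H1NG G N \<union> QG_restr G N) n"
  proof (rule quot_dim_transfer[OF _ _ _ _ n])
    fix w assume "w \<in> fspan cups"
    then obtain f where f: "controls w f" using controls_total[OF assms] unfolding fspan_cups by blast
    then have "f \<in> fspan (QNG G N)" using fspan_superset[of "QNG G N"] by (auto simp: controls_def)
    with f show "\<exists>f\<in>fspan (QNG G N). controls w f" ..
  next
    fix f assume "f \<in> QNG G N"
    then obtain w where w: "controls w f" using controls_onto by blast
    then have "w \<in> fspan cups" unfolding fspan_cups by (simp add: controls_def)
    with w show "\<exists>w\<in>fspan cups. controls w f" ..
  next
    fix w f assume "controls w f"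
    then show "w \<in> fspan (B2 G) \<longleftrightarrow> f \<in> fspan (H1NG G N \<union> QG_restr G N)"
      using controls_iff fspan_eq[OF flin_B2] by simp
  qed (rule controls_linear)
  then show ?thesis using n by blast
qed

end

section \<open>From the quotient group to conditions on \<open>G\<close> and
  \<open>N\<close>\<close>

lemma (in abelian_quotient) pullH1_eq_chars: "pullH1 G N = chars"
proof
  have coset_hom: "real_hom (G Mod N) (carrier (G Mod N)) \<chi> \<Longrightarrow> x \<in> carrier G \<Longrightarrow> y \<in> carrier G \<Longrightarrow>
      \<chi> (N #> (x \<otimes> y)) = \<chi> (N #> x) + \<chi> (N #> y)" for \<chi> x y
    using r_coset_hom_Mod unfolding real_hom_def hom_def by fastforce
  show "pullH1 G N \<subseteq> chars"
  proof
    fix a assume "a \<in> pullH1 G N"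
    then obtain \<chi> where \<chi>: "real_hom (G Mod N) (carrier (G Mod N)) \<chi>"
      and a: "a = (\<lambda>g. if g \<in> carrier G then \<chi> (N #> g) else 0)"
      unfolding pullH1_def by blast
    have "real_hom G (carrier G) a" unfolding real_hom_def a using coset_hom[OF \<chi>] by simp
    moreover have "a x = 0" if "x \<in> N" for x
    proof -
      have "N #> x = N #> \<one>" using that coset_join2[OF _ N_subgroup] by simp
      then have "a x = a \<one>" using that by (simp add: a)
      then show ?thesis using real_hom_one[OF subgroup_self \<open>real_hom G (carrier G) a\<close>] by simp
    qed
    ultimately show "a \<in> chars" by (simp add: chars_def)
  qed
  show "chars \<subseteq> pullH1 G N"
  proof
    fix a assume a: "a \<in> chars"
    \<comment> \<open>Evaluation at an arbitrary representative is well defined because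
      \<open>a\<close> is constant on cosets of \<open>N\<close>.\<close>
    define \<chi> where "\<chi> C = (if C \<in> carrier (G Mod N) then a (SOME x. x \<in> C) else 0)" for C
    have \<chi>: "\<chi> (N #> x) = a x" if x: "x \<in> carrier G" for x
    proof -
      have "x \<in> N #> x" using rcos_self[OF x N_subgroup] .
      then have "(SOME z. z \<in> N #> x) \<in> N #> x" by (rule someI)
      then obtain n where "n \<in> N" "(SOME z. z \<in> N #> x) = n \<otimes> x"
        unfolding r_coset_def by blast
      then have "a (SOME z. z \<in> N #> x) = a x"
        using chars_mult[OF a, of n x] chars_N[OF a] x by simp
      moreover have "N #> x \<in> carrier (G Mod N)"
        using x by (auto simp: FactGroup_def RCOSETS_def)
      ultimately show ?thesis by (simp add: \<chi>_def)
    qed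
    have "\<chi> (C \<otimes>\<^bsub>G Mod N\<^esub> C') = \<chi> C + \<chi> C'"
      if "C \<in> carrier (G Mod N)" "C' \<in> carrier (G Mod N)" for C C'
    proof -
      obtain x y where "x \<in> carrier G" "C = N #> x" "y \<in> carrier G" "C' = N #> y"
        using \<open>C \<in> _\<close> \<open>C' \<in> _\<close> by (auto simp: FactGroup_def RCOSETS_def)
      then show ?thesis using \<chi> chars_mult[OF a] by (simp add: FactGroup_def rcos_sum)
    qed
    then have "real_hom (G Mod N) (carrier (G Mod N)) \<chi>"
      unfolding real_hom_def by (simp add: \<chi>_def)
    moreover have "a = (\<lambda>g. if g \<in> carrier G then \<chi> (N #> g) else 0)"
      using \<chi> chars_outside[OF a] by auto
    ultimately show "a \<in> pullH1 G N" unfolding pullH1_def by blast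
  qed
qed

lemma abelian_quotientI:
  fixes G (structure)
  assumes "N \<lhd> G" "comm_group (G Mod N)"
  shows "abelian_quotient N G"
proof -
  interpret normal N G by fact
  interpret Q: comm_group "G Mod N" by fact
  show ?thesis
  proof
    fix x y assume x: "x \<in> carrier G" and y: "y \<in> carrier G"
    have "N #> (x \<otimes> y) = N #> (y \<otimes> x)"
      using Q.m_comm[of "N #> x" "N #> y"] x y
      by (auto simp: FactGroup_def RCOSETS_def rcos_sum)
    then have "x \<otimes> y \<in> N #> (y \<otimes> x)"
      using rcos_self[OF m_closed[OF x y] subgroup_axioms] by simp
    then obtain n where n: "n \<in> N" "x \<otimes> y = n \<otimes> (y \<otimes> x)"
      unfolding r_coset_def by blast
    then have "commut x y = n" using x y by (simp add: commut_def m_assoc inv_mult_group)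
    then show "commut x y \<in> N" using n by simp
  qed
qed

text \<open>Choose one preimage in \<open>G\<close> for each generator. A subgroup containing these
  preimages maps onto \<open>G / N\<close>, and containing \<open>N\<close> as well it must be all
  of \<open>G\<close>.\<close>

lemma fg_abelian_quotient_exists:
  fixes G (structure)
  assumes N: "N \<lhd> G" and "comm_group (G Mod N)"
    and S: "finite S" "S \<subseteq> carrier (G Mod N)" "generate (G Mod N) S = carrier (G Mod N)"
  shows "\<exists>T. fg_abelian_quotient N G T"
proof -
  interpret abelian_quotient N G using assms(1,2) by (rule abelian_quotientI)
  have "S \<subseteq> (\<lambda>x. N #> x) ` carrier G"
    using S(2) by (auto simp: FactGroup_def RCOSETS_def)
  then obtain T where T: "T \<subseteq> carrier G" "finite T" "S = (\<lambda>x. N #> x) ` T"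
    using finite_subset_image[OF S(1)] by metis
  have "fg_abelian_quotient N G T"
  proof
    show "finite T" "T \<subseteq> carrier G" by fact+
  next
    fix H assume H: "subgroup H G" "N \<subseteq> H" "T \<subseteq> H"
    interpret p: group_hom G "G Mod N" "\<lambda>x. N #> x"
      by (rule group_hom.intro[OF group_axioms factorgroup_is_group group_hom_axioms.intro[OF r_coset_hom_Mod]])
    have "generate (G Mod N) S \<subseteq> (\<lambda>x. N #> x) ` H"
      using p.subgroup_img_is_subgroup[OF H(1)] H(3) T(3)
      by (intro p.H.generate_subgroup_incl) auto
    then have sub: "carrier (G Mod N) \<subseteq> (\<lambda>x. N #> x) ` H" using S(3) by simp
    show "H = carrier G"
    proof
      show "H \<subseteq> carrier G" using subgroup.subset[OF H(1)] .
      show "carrier G \<subseteq> H"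
      proof
        fix x assume x: "x \<in> carrier G"
        then have "N #> x \<in> carrier (G Mod N)" by (auto simp: FactGroup_def RCOSETS_def)
        then obtain h where h: "h \<in> H" "N #> x = N #> h" using sub by blast
        then obtain n where "n \<in> N" "x = n \<otimes> h"
          using rcos_self[OF x N_subgroup] unfolding r_coset_def by auto
        then show "x \<in> H" using subgroup.m_closed[OF H(1)] H(2) h(1) by blast
      qed
    qed
  qed
  then show ?thesis ..
qed

theorem theorem11p6:
  fixes G :: "('a, 'b) monoid_scheme" and N :: "'a set"
  assumes "group G"
    and "N \<lhd> G"
    and "comm_group (G Mod N)"
    and "\<exists>S. finite S \<and> S \<subseteq> carrier (G Mod N) \<and> generate (G Mod N) S = carrier (G Mod N)"
    and "comparison2_surj G"
  shows "\<exists>n. quot_dim (QNG G N) (H1NG G N \<union> QG_restr G N) n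
           \<and> quot_dim {cup11 a b | a b. a \<in> pullH1 G N \<and> b \<in> pullH1 G N} (B2 G) n"
proof -
  obtain T where "fg_abelian_quotient N G T"
    using fg_abelian_quotient_exists[OF assms(2,3)] assms(4) by blast
  then interpret fg_abelian_quotient N G T .
  show ?thesis using dim_eq[OF assms(5)] unfolding pullH1_eq_chars .
qed

end
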